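(* Let $\Lambda=(\Lambda_i)_{i\le\kappa}$ be a repetitive, representable primitive substitution Delone $\kappa$-set in $\mathbb{R}^d$ with expansion map $Q$, and let $\mu$ be the unique invariant Borel probability measure of $(X_\Lambda,\mathbb{R}^d)$. Suppose that all the eigenvalues of $Q$ are algebraic integers. Assume that the set of eigenvalues of $(X_\Lambda,\mathbb{R}^d,\mu)$ is relatively dense in $\mathbb{R}^d$. Then $\mathrm{supp}(\Lambda)$ is a Meyer set.
   Context: A $\kappa$-set $\Lambda=(\Lambda_i)_{i\le\kappa}$ is a tuple of pairwise disjoint subsets of $\mathbb{R}^d$, identified with $\{(x,i):x\in\Lambda_i\}\subset\mathbb{R}^d\times\{1,\dots,\kappa\}$; $\mathrm{supp}(\Lambda)=\bigcup_i\Lambda_i$. It is a Delone $\kappa$-set if each $\Lambda_i$ and $\mathrm{supp}(\Lambda)$ are Delone (relatively dense and uniformly discrete). It is repetitive if for every cluster $G=(G_i)_{i\le\kappa}$ ($G_i\subset\Lambda_i$ finite) there is $M>0$ such that every ball of radius $M$ contains a translate of $G$ belonging to $\Lambda$. Finite local complexity is not assumed. A linear map $Q$ on $\mathbb{R}^d$ is expansive if all its (real and complex) eigenvalues have modulus $>1$. $\Lambda$ is a substitution Delone $\kappa$-set with expansion map $Q$ if it is a Delone $\kappa$-set and there are an expansive $Q$ and finite sets $\mathcal{D}_{ij}\subset\mathbb{R}^d$ such that $\Lambda_i=\bigcup_{j=1}^\kappa(Q\Lambda_j+\mathcal{D}_{ij})$ for $i\le\kappa$, all unions (over $j$ and over elements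 of $\mathcal{D}_{ij}$) being disjoint. It is primitive if some positive power of the matrix $(\#\mathcal{D}_{ij})_{i,j}$ has no zero entries. Let $(A_1,\dots,A_\kappa)$ be the unique family of nonempty compact sets solving $QA_j=\bigcup_{i=1}^\kappa(\mathcal{D}_{ij}+A_i)$, $j\le\kappa$, and $T_i=(A_i,i)$. $\Lambda$ is representable if the tiles $x+T_i=(x+A_i,i)$, $x\in\Lambda_i$, $i\le\kappa$, form a tiling of $\mathbb{R}^d$ (supports cover $\mathbb{R}^d$, distinct tiles have supports with disjoint interiors). Dynamical system: let $X$ be the collection of all Delone $\kappa$-sets in $\mathbb{R}^d$. For coloured sets, intersection with balls and addition of balls are applied to the $\mathbb{R}^d$-coordinate, keeping colours. Metric: $d(\Gamma,\Gamma')=\min\{2^{-1/2},\inf\{\epsilon>0:B_{1/\epsilon}(0)\cap\Gamma'\subset\Gamma+B_\epsilon(0),\ B_{1/\epsilon}(0)\cap\Gamma\subset\Gamma'+B_\epsilon(0)\}\}$. $X_\Lambda$ is the closure of $\{\Lambda-g:g\in\mathbb{R}^d\}$ in $X$; it is compact, and $\mathbb{R}^d$ acts by $\Gamma\mapsto\Gamma-g$; for $\Lambda$ as in the claim this system is uniquely ergodic. $\alpha\in\mathbb{R}^d$ is an eigenvalue of $(X_\Lambda,\mathbb{R}^d,\mu)$ if there is a nonzero $f\in L^2(X_\Lambda,\mu)$ with $f(\Gamma-x)=e^{2\pi i\langle x,\alpha\rangle}f(\Gamma)$ for all $x\in\mathbb{R}^d$ and $\mu$-a.e. $\Gamma$.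 A Delone set $Y\subset\mathbb{R}^d$ is Meyer if it is relatively dense and $Y-Y$ is uniformly discrete. *)

theory Defs
  imports "HOL-Analysis.Analysis" "HOL-Probability.Probability"
begin

section \<open>Delone sets and Meyer sets\<close>

definition relatively_dense :: "'a::metric_space set \<Rightarrow> bool" where
  "relatively_dense S \<longleftrightarrow> (\<exists>R>0. \<forall>y. \<exists>x\<in>S. dist y x < R)"

definition delone :: "'a::metric_space set \<Rightarrow> bool" where
  "delone S \<longleftrightarrow> relatively_dense S \<and> uniform_discrete S"

definition meyer :: "'a::real_normed_vector set \<Rightarrow> bool" where
  "meyer Y \<longleftrightarrow> delone Y \<and> relatively_dense Y \<and> uniform_discrete {x - y |x y. x \<in> Y \<and> y \<in> Y}"

section \<open>Coloured point sets\<close>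

text \<open>The colours \<open>{1, \<dots>, \<kappa>}\<close> are the elements of an arbitrary finite type \<open>'k\<close>, so
  \<open>\<kappa> = CARD('k) \<ge> 1\<close>; no order on the colours is ever used. The space is
  \<open>real ^ 'd\<close>.\<close>

type_synonym ('d, 'k) kset = "'k \<Rightarrow> (real ^ 'd) set"

definition supp :: "('d::finite, 'k::finite) kset \<Rightarrow> (real ^ 'd) set" where
  "supp \<Lambda> = (\<Union>i. \<Lambda> i)"

definition is_kset :: "('d::finite, 'k::finite) kset \<Rightarrow> bool" where
  "is_kset \<Lambda> \<longleftrightarrow> (\<forall>i j. i \<noteq> j \<longrightarrow> \<Lambda> i \<inter> \<Lambda> j = {})"

definition delone_kset :: "('d::finite, 'k::finite) kset \<Rightarrow> bool" where
  "delone_kset \<Lambda> \<longleftrightarrow> is_kset \<Lambda> \<and> (\<forall>i. delone (\<Lambda> i)) \<and> delone (supp \<Lambda>)"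

definition repetitive :: "('d::finite, 'k::finite) kset \<Rightarrow> bool" where
  "repetitive \<Lambda> \<longleftrightarrow>
     (\<forall>G. (\<forall>i. finite (G i) \<and> G i \<subseteq> \<Lambda> i) \<longrightarrow>
        (\<exists>M>0. \<forall>y. \<exists>t. \<forall>i. (+) t ` G i \<subseteq> \<Lambda> i \<inter> ball y M))"

section \<open>Substitution Delone sets\<close>

text \<open>The eigenvalues, real and complex, of a linear map on \<open>real ^ 'd\<close> are those of its
  complexification.\<close>

definition is_eigenvalue :: "(real ^ 'd \<Rightarrow> real ^ 'd) \<Rightarrow> complex \<Rightarrow> bool" where
  "is_eigenvalue Q z \<longleftrightarrow>
     (\<exists>v :: complex ^ 'd. v \<noteq> 0 \<and> map_matrix complex_of_real (matrix Q) *v v = z *s v)"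

definition expansive :: "(real ^ 'd \<Rightarrow> real ^ 'd) \<Rightarrow> bool" where
  "expansive Q \<longleftrightarrow> linear Q \<and> (\<forall>z. is_eigenvalue Q z \<longrightarrow> cmod z > 1)"

text \<open>The last conjunct says that the sets \<open>Q \<Lambda>\<^sub>j + a\<close> with \<open>a \<in> D\<^sub>i\<^sub>j\<close>,
  which make up \<open>\<Lambda>\<^sub>i\<close>, are disjoint for different pairs \<open>(j, a)\<close>.\<close>

definition substitution_delone_kset ::
  "(real ^ 'd \<Rightarrow> real ^ 'd) \<Rightarrow> ('k \<Rightarrow> 'k \<Rightarrow> (real ^ 'd) set) \<Rightarrow> ('d::finite, 'k::finite) kset \<Rightarrow> bool"
where
  "substitution_delone_kset Q D \<Lambda> \<longleftrightarrow>
     delone_kset \<Lambda> \<and> expansive Q \<and> (\<forall>i j. finite (D i j)) \<and>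
     (\<forall>i. \<Lambda> i = (\<Union>j. \<Union>a\<in>D i j. (\<lambda>x. Q x + a) ` \<Lambda> j)) \<and>
     (\<forall>i j a j' a'. a \<in> D i j \<and> a' \<in> D i j' \<and> (j, a) \<noteq> (j', a') \<longrightarrow>
        (\<lambda>x. Q x + a) ` \<Lambda> j \<inter> (\<lambda>x. Q x + a') ` \<Lambda> j' = {})"

definition substitution_matrix :: "('k \<Rightarrow> 'k \<Rightarrow> (real ^ 'd) set) \<Rightarrow> nat ^ 'k ^ 'k" where
  "substitution_matrix D = (\<chi> i j. card (D i j))"

definition primitive_substitution :: "('k::finite \<Rightarrow> 'k \<Rightarrow> (real ^ 'd) set) \<Rightarrow> bool" where
  "primitive_substitution D \<longleftrightarrow>
     (\<exists>n>0. \<forall>i j. (((**) (substitution_matrix D) ^^ n) (mat 1)) $ i $ j \<noteq> 0)"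

definition prototiles ::
  "(real ^ 'd \<Rightarrow> real ^ 'd) \<Rightarrow> ('k \<Rightarrow> 'k \<Rightarrow> (real ^ 'd) set) \<Rightarrow> ('k::finite \<Rightarrow> (real ^ 'd) set) \<Rightarrow> bool"
where
  "prototiles Q D A \<longleftrightarrow>
     (\<forall>j. compact (A j) \<and> A j \<noteq> {}) \<and>
     (\<forall>j. Q ` A j = (\<Union>i. {a + x |a x. a \<in> D i j \<and> x \<in> A i}))"

text \<open>A tile is a pair of a support and a colour.\<close>

definition tiling :: "((real ^ 'd) set \<times> 'k) set \<Rightarrow> bool" where
  "tiling \<T> \<longleftrightarrow>
     (\<Union>T\<in>\<T>. fst T) = UNIV \<and>
     (\<forall>S\<in>\<T>. \<forall>T\<in>\<T>. S \<noteq> T \<longrightarrow> interior (fst S) \<inter> interior (fst T) = {})"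

text \<open>For a primitive substitution with expansive \<open>Q\<close> there is exactly one family \<open>A\<close> with
  \<open>prototiles Q D A\<close>, so the existential quantifier only names it.\<close>

definition representable ::
  "(real ^ 'd \<Rightarrow> real ^ 'd) \<Rightarrow> ('k \<Rightarrow> 'k \<Rightarrow> (real ^ 'd) set) \<Rightarrow> ('d::finite, 'k::finite) kset \<Rightarrow> bool"
where
  "representable Q D \<Lambda> \<longleftrightarrow>
     (\<exists>A. prototiles Q D A \<and> tiling {((+) x ` A i, i) |x i. x \<in> \<Lambda> i})"

section \<open>The dynamical system\<close>

definition close_within :: "real \<Rightarrow> ('d::finite, 'k::finite) kset \<Rightarrow> ('d, 'k) kset \<Rightarrow> bool" where
  "close_within e \<Gamma> \<Gamma>' \<longleftrightarrow>
     (\<forall>i. ball 0 (1 / e) \<inter> \<Gamma>' i \<subseteq> {x + b |x b. x \<in> \<Gamma> i \<and> b \<in> ball 0 e} \<and>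
          ball 0 (1 / e) \<inter> \<Gamma> i \<subseteq> {x + b |x b. x \<in> \<Gamma>' i \<and> b \<in> ball 0 e})"

text \<open>The minimum of \<open>2 powr (-1/2)\<close> and an infimum, written as a single infimum. For Delone
  \<open>\<kappa>\<close>-sets the infimum is over a nonempty set; the single infimum also gives the value
  \<open>2 powr (-1/2)\<close>, that is \<open>Inf {} = \<infinity>\<close>, on other arguments, where \<open>Inf\<close> on
  the reals would be unspecified.\<close>

definition kset_dist :: "('d::finite, 'k::finite) kset \<Rightarrow> ('d, 'k) kset \<Rightarrow> real" where
  "kset_dist \<Gamma> \<Gamma>' = Inf (insert (2 powr (-1/2)) {e. e > 0 \<and> close_within e \<Gamma> \<Gamma>'})"

definition translate :: "real ^ 'd \<Rightarrow> ('d::finite, 'k::finite) kset \<Rightarrow> ('d, 'k) kset" where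
  "translate g \<Gamma> = (\<lambda>i. (\<lambda>x. x - g) ` \<Gamma> i)"

definition kset_topology :: "('d::finite, 'k::finite) kset topology" where
  "kset_topology = Metric_space.mtopology {\<Gamma>. delone_kset \<Gamma>} kset_dist"

definition kset_hull :: "('d::finite, 'k::finite) kset \<Rightarrow> ('d, 'k) kset set" where
  "kset_hull \<Lambda> = kset_topology closure_of (range (\<lambda>g. translate g \<Lambda>))"

definition kset_hull_borel :: "('d::finite, 'k::finite) kset \<Rightarrow> ('d, 'k) kset measure" where
  "kset_hull_borel \<Lambda> = sigma (kset_hull \<Lambda>) {U. openin (subtopology kset_topology (kset_hull \<Lambda>)) U}"

text \<open>For a repetitive representable primitive substitution Delone \<open>\<kappa>\<close>-set the hull is
  uniquely ergodic, so at most one \<open>\<mu>\<close> satisfies the following.\<close>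

definition invariant_prob_measure ::
  "('d::finite, 'k::finite) kset \<Rightarrow> ('d, 'k) kset measure \<Rightarrow> bool" where
  "invariant_prob_measure \<Lambda> \<mu> \<longleftrightarrow>
     prob_space \<mu> \<and> sets \<mu> = sets (kset_hull_borel \<Lambda>) \<and> (\<forall>g. distr \<mu> \<mu> (translate g) = \<mu>)"

definition dynamical_eigenvalue ::
  "('d::finite, 'k::finite) kset measure \<Rightarrow> real ^ 'd \<Rightarrow> bool" where
  "dynamical_eigenvalue \<mu> \<alpha> \<longleftrightarrow>
     (\<exists>f :: ('d, 'k) kset \<Rightarrow> complex.
        f \<in> borel_measurable \<mu> \<and> integrable \<mu> (\<lambda>\<Gamma>. (cmod (f \<Gamma>))\<^sup>2) \<and>
        \<not> (AE \<Gamma> in \<mu>. f \<Gamma> = 0) \<and>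
        (\<forall>x. AE \<Gamma> in \<mu>. f (translate x \<Gamma>) = exp (2 * pi * \<i> * (x \<bullet> \<alpha>)) * f \<Gamma>))"

text \<open>\<open>Metric_space.mtopology\<close> is meaningful only for a metric.\<close>

lemma close_within_commute: "close_within e \<Gamma> \<Gamma>' \<longleftrightarrow> close_within e \<Gamma>' \<Gamma>"
  unfolding close_within_def by blast

lemma close_within_iff:
  "close_within e \<Gamma> \<Gamma>' \<longleftrightarrow>
     (\<forall>i. (\<forall>y\<in>\<Gamma>' i. norm y < 1 / e \<longrightarrow> (\<exists>x\<in>\<Gamma> i. dist x y < e)) \<and>
          (\<forall>y\<in>\<Gamma> i. norm y < 1 / e \<longrightarrow> (\<exists>x\<in>\<Gamma>' i. dist x y < e)))"
proof -
  have mem: "y \<in> {x + b |x b. x \<in> S \<and> b \<in> ball 0 e} \<longleftrightarrow> (\<exists>x\<in>S. dist x y < e)"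
    for y :: "real ^ 'd" and S
  proof
    assume "\<exists>x\<in>S. dist x y < e"
    then obtain x where "x \<in> S" "dist x y < e" by blast
    then have "y = x + (y - x)" "y - x \<in> ball 0 e" 
      by (auto simp: dist_norm norm_minus_commute)
    with \<open>x \<in> S\<close> show "y \<in> {x + b |x b. x \<in> S \<and> b \<in> ball 0 e}" by blast
  next
    assume "y \<in> {x + b |x b. x \<in> S \<and> b \<in> ball 0 e}"
    then obtain x b where "y = x + b" "x \<in> S" "norm b < e" by auto
    then show "\<exists>x\<in>S. dist x y < e" by (intro bexI[of _ x]) (simp_all add: dist_norm)
  qed
  have "{x + b |x b. x \<in> S \<and> b \<in> ball 0 e} = {y. \<exists>x\<in>S. dist x y < e}"
    for S :: "(real ^ 'b) set"
    by (intro set_eqI, subst mem) simp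
  then show ?thesis
    unfolding close_within_def by (simp add: subset_iff) blast
qed

lemma kset_dist_less_iff:
  "kset_dist \<Gamma> \<Gamma>' < r \<longleftrightarrow>
     2 powr (-1/2) < r \<or> (\<exists>e>0. e < r \<and> close_within e \<Gamma> \<Gamma>')"
proof -
  have "bdd_below (insert (2 powr (-1/2)) {e. e > 0 \<and> close_within e \<Gamma> \<Gamma>'})"
    by (intro bdd_belowI[of _ 0]) auto
  then show ?thesis
    unfolding kset_dist_def by (subst cInf_less_iff) auto
qed

lemma kset_dist_nonneg: "0 \<le> kset_dist \<Gamma> \<Gamma>'"
  unfolding kset_dist_def by (rule cInf_greatest) auto

lemma kset_dist_commute: "kset_dist \<Gamma> \<Gamma>' = kset_dist \<Gamma>' \<Gamma>"
  unfolding kset_dist_def using close_within_commute by metis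

lemma kset_dist_le: "kset_dist \<Gamma> \<Gamma>' \<le> 2 powr (-1/2)"
  unfolding kset_dist_def by (rule cInf_lower) (auto intro!: bdd_belowI[of _ 0])

lemma close_within_self: "e > 0 \<Longrightarrow> close_within e \<Gamma> \<Gamma>"
  unfolding close_within_iff by (metis dist_self)

lemma close_within_trans:
  assumes "close_within a \<Gamma> \<Gamma>'" "close_within b \<Gamma>' \<Gamma>''"
    and ab: "a > 0" "b > 0" "a + b \<le> 2 powr (-1/2)"
  shows "close_within (a + b) \<Gamma> \<Gamma>''"
proof -
  have "(2 powr (-1/2)) * (2 powr (-1/2)) = (1/2::real)"
    by (simp flip: powr_add add: powr_minus_divide)
  then have "(a + b) * (a + b) \<le> 1/2"
    using mult_mono[OF ab(3) ab(3)] ab by simp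
  moreover have "a * (a + b) \<le> (a + b) * (a + b)" "b * (a + b) \<le> (a + b) * (a + b)"
    using ab by (auto intro: mult_right_mono)
  ultimately have *: "a * (a + b) \<le> 1" "b * (a + b) \<le> 1" by linarith+
  have id: "1 / c = 1 / (c + d) + d / (c * (c + d))" if "c > 0" "d > 0" for c d :: real
  proof -
    have "c + d \<noteq> 0" "c \<noteq> 0" using that by auto
    then have "1 / c - 1 / (c + d) = d / (c * (c + d))" by (simp add: diff_frac_eq)
    then show ?thesis by simp
  qed
  from * have "b \<le> b / (a * (a + b))" "a \<le> a / (b * (a + b))"
    using ab by (simp_all add: le_divide_eq)
  moreover have "1 / a = 1 / (a + b) + b / (a * (a + b))" "1 / b = 1 / (a + b) + a / (b * (a + b))"
    using id[of a b] id[of b a] ab by (simp_all add: add.commute)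
  ultimately have le: "1 / (a + b) + b \<le> 1 / a" "1 / (a + b) + a \<le> 1 / b" by linarith+
  have step: "\<exists>z\<in>R. dist z y < a' + b'"
    if yS: "y \<in> S" and ny: "norm y < 1 / (a' + b')"
      and 1: "\<And>y. y \<in> S \<Longrightarrow> norm y < 1 / b' \<Longrightarrow> \<exists>x\<in>T. dist x y < b'"
      and 2: "\<And>y. y \<in> T \<Longrightarrow> norm y < 1 / a' \<Longrightarrow> \<exists>x\<in>R. dist x y < a'"
      and le: "1 / (a' + b') + b' \<le> 1 / a'" and pos: "a' > 0" "b' > 0"
    for S T R :: "(real ^ 'b) set" and y and a' b' :: real
  proof -
    have "1 / (a' + b') \<le> 1 / b'" using pos by (simp add: field_simps)
    then obtain x where x: "x \<in> T" "dist x y < b'" using yS ny 1[of y] by auto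
    have "norm x \<le> norm y + dist x y"
      using norm_triangle_sub[of x y] by (simp add: dist_norm)
    then have "norm x < 1 / a'" using x ny le by linarith
    then obtain z where "z \<in> R" "dist z x < a'" using 2 x by blast
    then show ?thesis using x dist_triangle[of z y x] by (intro bexI[of _ z]) auto
  qed
  show ?thesis
    unfolding close_within_iff
  proof (intro allI conjI ballI impI)
    fix i y assume "y \<in> \<Gamma>'' i" "norm y < 1 / (a + b)"
    then show "\<exists>x\<in>\<Gamma> i. dist x y < a + b"
      using assms le(1) unfolding close_within_iff
      by (intro step[where S = "\<Gamma>'' i" and T = "\<Gamma>' i"]) auto
  next
    fix i y assume "y \<in> \<Gamma> i" "norm y < 1 / (a + b)"
    then have "\<exists>x\<in>\<Gamma>'' i. dist x y < b + a"
      using assms le(2) unfolding close_within_iff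
      by (intro step[where S = "\<Gamma> i" and T = "\<Gamma>' i"]) (auto simp: add.commute)
    then show "\<exists>x\<in>\<Gamma>'' i. dist x y < a + b" by (simp add: add.commute)
  qed
qed

lemma kset_dist_triangle: "kset_dist \<Gamma> \<Gamma>'' \<le> kset_dist \<Gamma> \<Gamma>' + kset_dist \<Gamma>' \<Gamma>''"
proof (rule ccontr)
  define s where "s = kset_dist \<Gamma> \<Gamma>''"
  define m where "m = (s - kset_dist \<Gamma> \<Gamma>' - kset_dist \<Gamma>' \<Gamma>'') / 2"
  assume "\<not> ?thesis"
  then have m: "m > 0" "kset_dist \<Gamma> \<Gamma>' + m + (kset_dist \<Gamma>' \<Gamma>'' + m) = s"
    by (auto simp: m_def s_def field_simps)
  have s: "s \<le> 2 powr (-1/2)" unfolding s_def by (rule kset_dist_le)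
  have "kset_dist \<Gamma> \<Gamma>' + m \<le> s" "kset_dist \<Gamma>' \<Gamma>'' + m \<le> s"
    using m kset_dist_nonneg[of \<Gamma> \<Gamma>'] kset_dist_nonneg[of \<Gamma>' \<Gamma>''] by linarith+
  then obtain a b where ab: "a > 0" "a < kset_dist \<Gamma> \<Gamma>' + m" "close_within a \<Gamma> \<Gamma>'"
      "b > 0" "b < kset_dist \<Gamma>' \<Gamma>'' + m" "close_within b \<Gamma>' \<Gamma>''"
    using kset_dist_less_iff[of \<Gamma> \<Gamma>' "kset_dist \<Gamma> \<Gamma>' + m"] 
      kset_dist_less_iff[of \<Gamma>' \<Gamma>'' "kset_dist \<Gamma>' \<Gamma>'' + m"] m(1) s by auto
  then have "a + b < s" using m by linarith
  moreover have "close_within (a + b) \<Gamma> \<Gamma>''"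
    using close_within_trans ab s \<open>a + b < s\<close> by (meson less_le_trans less_imp_le)
  ultimately have "kset_dist \<Gamma> \<Gamma>'' < s"
    using ab unfolding kset_dist_less_iff by (meson add_pos_pos)
  then show False by (simp add: s_def)
qed

lemma kset_dist_zero_imp_subset:
  assumes "kset_dist \<Gamma> \<Gamma>' = 0" "closed (\<Gamma>' i)"
  shows "\<Gamma> i \<subseteq> \<Gamma>' i"
proof
  fix y assume y: "y \<in> \<Gamma> i"
  have "\<exists>x\<in>\<Gamma>' i. dist x y < r" if "r > 0" for r
  proof -
    define q where "q = min r (min (2 powr (-1/2)) (1 / (norm y + 1)))"
    have "q > 0" using that by (auto simp: q_def add_nonneg_pos)
    then obtain e where e: "e > 0" "e < q" "close_within e \<Gamma> \<Gamma>'"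
      using assms(1) kset_dist_less_iff[of \<Gamma> \<Gamma>' q] by (auto simp: q_def)
    have "e < 1 / (norm y + 1)" using e by (simp add: q_def)
    then have "e * (norm y + 1) < 1" 
      by (simp add: less_divide_eq add_nonneg_pos split: if_splits)
    then have "norm y < 1 / e" using e by (simp add: field_simps)
    then obtain x where "x \<in> \<Gamma>' i" "dist x y < e"
      using e y unfolding close_within_iff by blast
    then show ?thesis using e by (intro bexI[of _ x]) (auto simp: q_def)
  qed
  then show "y \<in> \<Gamma>' i"
    using assms(2) by (metis closed_approachable)
qed

lemma Metric_space_kset_dist: "Metric_space {\<Gamma>. delone_kset \<Gamma>} kset_dist"
proof
  fix \<Gamma> \<Gamma>' :: "('d::finite, 'k::finite) kset"
  assume "\<Gamma> \<in> {\<Gamma>. delone_kset \<Gamma>}" "\<Gamma>' \<in> {\<Gamma>. delone_kset \<Gamma>}"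
  then have cl: "closed (\<Gamma> i)" "closed (\<Gamma>' i)" for i
    by (auto simp: delone_kset_def delone_def intro: uniform_discrete_imp_closed)
  show "kset_dist \<Gamma> \<Gamma>' = 0 \<longleftrightarrow> \<Gamma> = \<Gamma>'"
  proof
    assume "kset_dist \<Gamma> \<Gamma>' = 0"
    then have "\<Gamma> i = \<Gamma>' i" for i
      using kset_dist_zero_imp_subset[of \<Gamma> \<Gamma>' i] kset_dist_zero_imp_subset[of \<Gamma>' \<Gamma> i] cl
      by (simp add: kset_dist_commute)
    then show "\<Gamma> = \<Gamma>'" by auto
  next
    assume "\<Gamma> = \<Gamma>'"
    have "\<not> kset_dist \<Gamma> \<Gamma> > 0"
    proof
      assume p: "kset_dist \<Gamma> \<Gamma> > 0"
      then have "kset_dist \<Gamma> \<Gamma> < kset_dist \<Gamma> \<Gamma>"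
        by (subst kset_dist_less_iff) (metis close_within_self dense)
      then show False by simp
    qed
    then show "kset_dist \<Gamma> \<Gamma>' = 0"
      using kset_dist_nonneg[of \<Gamma> \<Gamma>] \<open>\<Gamma> = \<Gamma>'\<close> by simp
  qed
qed (auto intro: kset_dist_nonneg kset_dist_commute kset_dist_triangle)

end

theory Submission
  imports Defs "HOL-Computational_Algebra.Fundamental_Theorem_Algebra"
begin

text \<open>Let \<open>x\<close> be a difference of two points of the same colour and \<open>\<alpha>\<close> a dynamical eigenvalue. By
  repetitivity, \<open>\<Lambda>\<close> contains many pairs of \<open>n\<close>-th supertiles which differ by the translation \<open>Q\<^sup>n x\<close>;
  hence boundedly many translates of the set of those \<open>\<Gamma>\<close> in the hull which \<open>Q\<^sup>n x\<close> hardly moves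
  cover the hull, and \<open>exp (2 \<pi> \<i> \<langle>Q\<^sup>n x, \<alpha>\<rangle>)\<close> tends to \<open>1\<close>. As the eigenvalues of \<open>Q\<close> are algebraic
  integers, \<open>\<langle>Q\<^sup>n x, \<alpha>\<rangle>\<close> satisfies an integral monic linear recurrence, which makes its distance to the
  integers decay exponentially and therefore summable. A point of \<open>\<Lambda>\<close> is, up to finitely many
  constants, a sum of \<open>Q\<^sup>m u\<^sub>m\<close> with \<open>u\<^sub>m\<close> in a finite set of such differences \<open>x\<close>. By the summability, a
  short nonzero vector of this form would, after applying a power of \<open>Q\<close>, have a pairing with one of
  finitely many spanning \<open>\<alpha>\<close> that is both close to an integer and not.\<close>

section \<open>Linear recurrences and eigenvalues\<close>

text \<open>Eigenfunctions are only measurable, so phases cannot be compared by evaluating them at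
  nearby points; a measure estimate stands in for continuity. It needs the number of covering
  translates to be bounded independently of the level \<open>n\<close> and of the precision, because
  the precision is chosen after that bound has entered the estimate. The bound comes from rescaling
  by the inverse of \<open>Q ^^ n\<close>, which turns the supertiles of a given colour at every
  level into translates of one prototile. Without finite local complexity, differences of points of
  \<Lambda> may take infinitely many values in a bounded region. Measuring points against one fixed
  base point per colour nevertheless leaves only finitely many digits. \<open>Q\<close> may have
  Jordan blocks, and its characteristic polynomial may have non-integral coefficients. For this
  reason both the exponential contraction and the integral recurrence are derived by stripping off
  one linear factor at a time, and never from a diagonal form or from the characteristic
  polynomial.\<close>

definition shift_poly :: "'a::comm_ring_1 poly \<Rightarrow> (nat \<Rightarrow> 'a) \<Rightarrow> nat \<Rightarrow> 'a" where
  "shift_poly p s n = (\<Sum>i\<le>degree p. coeff p i * s (n + i))"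

lemma shift_poly_le_degree:
  "degree p \<le> N \<Longrightarrow> shift_poly p s n = (\<Sum>i\<le>N. coeff p i * s (n + i))"
  unfolding shift_poly_def by (rule sum.mono_neutral_left) (auto simp: coeff_eq_0)

lemma shift_poly_0 [simp]: "shift_poly 0 s = (\<lambda>n. 0)"
  by (auto simp: shift_poly_def)

lemma shift_poly_pCons: "shift_poly (pCons a p) s n = a * s n + shift_poly p s (Suc n)"
proof -
  have "shift_poly (pCons a p) s n = (\<Sum>i\<le>Suc (degree p). coeff (pCons a p) i * s (n + i))"
    by (rule shift_poly_le_degree) (rule degree_pCons_le)
  also have "\<dots> = a * s n + (\<Sum>i\<le>degree p. coeff p i * s (Suc n + i))"
    by (subst sum.atMost_Suc_shift) simp
  finally show ?thesis by (simp add: shift_poly_def)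
qed

lemma shift_poly_add: "shift_poly (p + q) s n = shift_poly p s n + shift_poly q s n"
proof -
  let ?N = "max (degree p) (degree q)"
  have "degree (p + q) \<le> ?N" by (rule degree_add_le_max)
  then show ?thesis
    by (simp add: shift_poly_le_degree[of _ ?N] sum.distrib algebra_simps)
qed

lemma shift_poly_smult: "shift_poly (smult c p) s n = c * shift_poly p s n"
  by (subst shift_poly_le_degree[OF degree_smult_le])
     (simp add: shift_poly_def sum_distrib_left mult.assoc)

text \<open>\<open>shift_poly p\<close> is the polynomial p evaluated at the shift operator, so
  sequences form a module over the polynomial ring. This is the module law; it lets a root of p be
  split off to lower the order of a recurrence.\<close>

lemma shift_poly_mult: "shift_poly (p * q) s n = shift_poly p (shift_poly q s) n"
  by (induction p arbitrary: n) (simp_all add: shift_poly_add shift_poly_smult shift_poly_pCons)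

lemma shift_poly_zero_seq [simp]: "shift_poly p (\<lambda>n. 0) = (\<lambda>n. 0)"
  by (auto simp: shift_poly_def)

lemma shift_poly_linear: "shift_poly [:- l, 1:] s n = s (Suc n) - l * s n"
  by (simp add: shift_poly_pCons)

text \<open>Powers of M commute with M - l, so replacing v by M v - l v applies the factor X - l, in
  the shift, to every coordinate of the orbit of v.\<close>

lemma funpow_matrix_diff:
  fixes M :: "'a::field ^ 'n ^ 'n"
  shows "((*v) M ^^ n) (M *v v - l *s v) = ((*v) M ^^ Suc n) v - l *s ((*v) M ^^ n) v"
proof (induction n)
  case (Suc n)
  have "((*v) M ^^ Suc n) (M *v v - l *s v) = M *v (((*v) M ^^ Suc n) v - l *s ((*v) M ^^ n) v)"
    using Suc by simp
  then show ?case by (simp add: matrix_vector_mult_diff_distrib vector_scalar_commute)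
qed simp

text \<open>Killing the vector by a product of factors \<open>M - l\<close>, those with \<open>l\<close> not an eigenvalue
  can be cancelled, and the others are handled by the hypothesis one at a time.\<close>

lemma eigenvalue_induct:
  fixes M :: "complex ^ 'n ^ 'n"
  assumes zero: "P 0"
    and step: "\<And>v l. (\<exists>u. u \<noteq> 0 \<and> M *v u = l *s u) \<Longrightarrow> P (M *v v - l *s v) \<Longrightarrow> P v"
  shows "P v"
proof -
  let ?T = "\<lambda>n v. (((*v) M) ^^ n) v"
  have main: "P v" if "degree p = m" "p \<noteq> 0" "\<And>k n. shift_poly p (\<lambda>n. ?T n v $ k) n = 0" for p m v
    using that
  proof (induction m arbitrary: p v)
    case 0
    then obtain c where "p = [:c:]" "c \<noteq> 0" by (metis degree_eq_zeroE pCons_0_0)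
    then have "v $ k = 0" for k using 0(3)[of k 0] by (simp add: shift_poly_def)
    then have "v = 0" by (simp add: vec_eq_iff)
    then show ?case using zero by simp
  next
    case (Suc m)
    then have "\<not> constant (poly p)" by (simp add: constant_degree)
    then obtain l where "poly p l = 0" using fundamental_theorem_of_algebra by blast
    then obtain q where q: "p = [:- l, 1:] * q" by (metis poly_eq_0_iff_dvd dvdE)
    have "q \<noteq> 0" using q Suc by auto
    then have "degree p = degree [:- l, 1:] + degree q" unfolding q by (intro degree_mult_eq) auto
    then have dq: "degree q = m" using Suc(2) by simp
    have "shift_poly q (\<lambda>n. ?T n (M *v v - l *s v) $ k) n = 0" for k n
    proof -
      have "(\<lambda>n. ?T n (M *v v - l *s v) $ k) = shift_poly [:- l, 1:] (\<lambda>n. ?T n v $ k)"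
        unfolding funpow_matrix_diff by (rule ext) (simp add: shift_poly_linear)
      then show ?thesis
        using Suc(4)[of k n] q by (simp only: shift_poly_mult[symmetric] mult.commute)
    qed
    then have Pw: "P (M *v v - l *s v)" using Suc(1) dq \<open>q \<noteq> 0\<close> by blast
    show ?case
    proof (cases "\<exists>u. u \<noteq> 0 \<and> M *v u = l *s u")
      case True
      then show ?thesis using step Pw by blast
    next
      case False
      \<comment> \<open>Since all of p annihilates the orbit, each \<open>u n\<close> satisfies the
        eigenvector equation for \<open>l\<close>. As \<open>l\<close> is not an eigenvalue,
        \<open>u n\<close> vanishes, and q, of smaller degree, annihilates the orbit of the same
        vector v.\<close>
      define u where "u n = (\<Sum>i\<le>degree q. coeff q i *s ?T (n + i) v)" for n
      have u: "u n $ k = shift_poly q (\<lambda>n. ?T n v $ k) n" for n k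
        by (simp add: u_def shift_poly_def)
      have uSuc: "M *v u n = u (Suc n)" for n
        by (simp add: u_def matrix_vector_mult_def vec_eq_iff sum_distrib_left)
           (subst sum.swap, simp add: mult_ac)
      have "u (Suc n) $ k = l * u n $ k" for n k
        using Suc(4)[of k n] unfolding q shift_poly_mult shift_poly_linear u by simp
      then have "M *v u n = l *s u n" for n
        by (simp add: uSuc vec_eq_iff)
      then have "u n = 0" for n using False by blast
      then have "shift_poly q (\<lambda>n. ?T n v $ k) n = 0" for k n by (metis u zero_index)
      then show ?thesis using Suc(1) dq \<open>q \<noteq> 0\<close> by blast
    qed
  qed
  have "\<exists>p. p \<noteq> 0 \<and> (\<forall>k n. shift_poly p (\<lambda>n. ?T n v $ k) n = 0)"
  proof -
    \<comment> \<open>An annihilating polynomial comes from a real linear dependence among the first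
      D + 1 iterates, D being the real dimension. If two of them coincide, a difference of two
      monomials does.\<close>
    let ?D = "DIM(complex ^ 'n)"
    have "\<exists>c. (\<exists>i\<le>?D. c i \<noteq> (0::real)) \<and> (\<Sum>i\<le>?D. c i *\<^sub>R ?T i v) = 0"
    proof (cases "inj_on (\<lambda>i. ?T i v) {..?D}")
      case True
      then have "card ((\<lambda>i. ?T i v) ` {..?D}) = Suc ?D" by (simp add: card_image)
      then have "dependent ((\<lambda>i. ?T i v) ` {..?D})"
        by (intro dependent_biggerset) auto
      then obtain c where c: "\<exists>x\<in>(\<lambda>i. ?T i v) ` {..?D}. c x \<noteq> 0"
          "(\<Sum>x\<in>(\<lambda>i. ?T i v) ` {..?D}. c x *\<^sub>R x) = 0"
        by (subst (asm) dependent_finite) auto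
      then show ?thesis
        using True by (intro exI[of _ "\<lambda>i. c (?T i v)"]) (auto simp: sum.reindex)
    next
      case False
      then obtain i j where ij: "i \<le> ?D" "j \<le> ?D" "i \<noteq> j" "?T i v = ?T j v"
        unfolding inj_on_def by auto
      let ?c = "\<lambda>m. if m = i then 1 else if m = j then - 1 else (0::real)"
      have "(\<Sum>m\<le>?D. ?c m *\<^sub>R ?T m v) = (\<Sum>m\<in>{i, j}. ?c m *\<^sub>R ?T m v)"
        using ij by (intro sum.mono_neutral_right) auto
      also have "\<dots> = 0" using ij by simp
      finally show ?thesis using ij by (intro exI[of _ ?c]) auto
    qed
    then obtain c i where c: "i \<le> ?D" "c i \<noteq> (0::real)" "(\<Sum>i\<le>?D. c i *\<^sub>R ?T i v) = 0"
      by blast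
    define p where "p = (\<Sum>i\<le>?D. monom (complex_of_real (c i)) i)"
    have cf: "coeff p m = (if m \<le> ?D then c m else 0)" for m
      by (simp add: p_def coeff_sum coeff_monom sum.delta)
    then have "coeff p i \<noteq> 0" using c by simp
    then have "p \<noteq> 0" by auto
    moreover have deg: "degree p \<le> ?D" using cf by (intro degree_le) auto
    have "(\<Sum>i\<le>?D. coeff p i * ?T (n + i) v $ k) = 0" for k n
    proof -
      have "(\<Sum>i\<le>?D. c i *\<^sub>R ?T (n + i) v) = 0"
      proof (induction n)
        case (Suc n)
        have "M *v (\<Sum>i\<le>?D. c i *\<^sub>R ?T (n + i) v) = (\<Sum>i\<le>?D. c i *\<^sub>R ?T (Suc n + i) v)"
          by (simp add: linear_sum linear_cmul)
        then show ?case using Suc by simp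
      qed (use c in simp)
      from arg_cong[OF this, of "\<lambda>x. x $ k"]
      have "(\<Sum>i\<le>?D. c i *\<^sub>R (?T (n + i) v $ k)) = 0"
        by (simp only: sum_component vector_scaleR_component zero_index)
      moreover have "coeff p i * ?T (n + i) v $ k = c i *\<^sub>R (?T (n + i) v $ k)" if "i \<le> ?D" for i
        using that by (simp only: cf if_True scaleR_conv_of_real)
      then have "(\<Sum>i\<le>?D. coeff p i * ?T (n + i) v $ k) = (\<Sum>i\<le>?D. c i *\<^sub>R (?T (n + i) v $ k))"
        by (intro sum.cong) auto
      ultimately show ?thesis by (simp only:)
    qed
    then have "shift_poly p (\<lambda>n. ?T n v $ k) n = 0" for k n
      unfolding shift_poly_le_degree[OF deg] .
    ultimately show ?thesis by blast
  qed
  then show ?thesis using main by blast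
qed

section \<open>Complexification and integral recurrences\<close>

definition complex_vec :: "real ^ 'd \<Rightarrow> complex ^ 'd" where
  "complex_vec x = (\<chi> i. complex_of_real (x $ i))"

lemma norm_complex_vec: "norm (complex_vec x) = norm x"
  by (simp add: complex_vec_def norm_vec_def)

lemma complex_vec_matrix:
  fixes Q :: "real ^ 'd \<Rightarrow> real ^ 'd"
  assumes "linear Q"
  shows "map_matrix complex_of_real (matrix Q) *v complex_vec x = complex_vec (Q x)"
proof -
  have "Q x = matrix Q *v x" using assms by simp
  then show ?thesis
    by (simp add: complex_vec_def matrix_vector_mult_def vec_eq_iff map_matrix_def)
qed

lemma complex_vec_funpow:
  fixes Q :: "real ^ 'd \<Rightarrow> real ^ 'd"
  assumes "linear Q"
  shows "((*v) (map_matrix complex_of_real (matrix Q)) ^^ n) (complex_vec x) = complex_vec ((Q ^^ n) x)"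
  by (induction n) (simp_all add: complex_vec_matrix assms)

lemma shift_poly_sum:
  "finite A \<Longrightarrow> shift_poly p (\<lambda>n. \<Sum>k\<in>A. s k n * c k) n = (\<Sum>k\<in>A. shift_poly p (s k) n * c k)"
  by (simp add: shift_poly_def sum_distrib_left sum_distrib_right mult.assoc) (rule sum.swap)

text \<open>Integer coefficients inside complex polynomials, so that linear factors at complex
  eigenvalues can be split off without changing the ring.\<close>

definition integer_monic :: "complex poly \<Rightarrow> bool" where
  "integer_monic p \<longleftrightarrow> lead_coeff p = 1 \<and> (\<forall>i. coeff p i \<in> \<int>)"

lemma integer_monic_mult: "integer_monic p \<Longrightarrow> integer_monic q \<Longrightarrow> integer_monic (p * q)"
  unfolding integer_monic_def lead_coeff_mult by (auto simp: coeff_mult)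

text \<open>If p annihilates the orbit of M v - l v and r is a monic integer polynomial with root l,
  then p * r annihilates the orbit of v, because X - l divides r. Taking a whole r for each
  eigenvalue, instead of just X - l, keeps the coefficients integral.\<close>

lemma integer_recurrence:
  fixes Q :: "real ^ 'd \<Rightarrow> real ^ 'd"
  assumes lin: "linear Q" and alg: "\<And>z. is_eigenvalue Q z \<Longrightarrow> algebraic_int z"
  shows "\<exists>p. integer_monic p \<and>
           (\<forall>n. shift_poly p (\<lambda>n. complex_of_real ((Q ^^ n) x \<bullet> a)) n = 0)"
proof -
  define M where "M = map_matrix complex_of_real (matrix Q)"
  let ?P = "\<lambda>v. \<exists>p. integer_monic p \<and> (\<forall>k n. shift_poly p (\<lambda>n. ((*v) M ^^ n) v $ k) n = 0)"
  have "?P (complex_vec x)"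
  proof (rule eigenvalue_induct[of ?P M])
    show "?P 0"
    proof (intro exI[of _ 1] conjI allI)
      show "integer_monic 1" by (simp add: integer_monic_def coeff_1)
      fix k :: 'd and n
      have "((*v) M ^^ n) 0 = 0" for n by (induction n) auto
      then show "shift_poly 1 (\<lambda>n. ((*v) M ^^ n) 0 $ k) n = 0" by simp
    qed
  next
    fix v l assume l: "\<exists>u. u \<noteq> 0 \<and> M *v u = l *s u" and "?P (M *v v - l *s v)"
    then obtain p where p: "integer_monic p"
        "\<And>k. shift_poly p (\<lambda>n. ((*v) M ^^ n) (M *v v - l *s v) $ k) = (\<lambda>n. 0)"
      by blast
    have "algebraic_int l" using alg l unfolding is_eigenvalue_def M_def by blast
    then obtain r where r: "integer_monic r" "poly r l = 0"
      unfolding integer_monic_def by (auto elim!: algebraic_int.cases)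
    then obtain s where s: "r = [:- l, 1:] * s" by (metis poly_eq_0_iff_dvd dvdE)
    have "shift_poly (p * r) (\<lambda>n. ((*v) M ^^ n) v $ k) n = 0" for k n
    proof -
      have "(\<lambda>n. ((*v) M ^^ n) (M *v v - l *s v) $ k) = shift_poly [:- l, 1:] (\<lambda>n. ((*v) M ^^ n) v $ k)"
        unfolding funpow_matrix_diff by (rule ext) (simp add: shift_poly_linear)
      then have "shift_poly (s * (p * [:- l, 1:])) (\<lambda>n. ((*v) M ^^ n) v $ k) n = 0"
        using p(2)[of k] by (simp only: shift_poly_mult[abs_def] shift_poly_zero_seq)
      moreover have "p * r = s * (p * [:- l, 1:])" unfolding s by (simp only: mult_ac)
      ultimately show ?thesis by simp
    qed
    then show "?P v" using integer_monic_mult p(1) r(1) by blast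
  qed
  then obtain p where p: "integer_monic p"
      "\<And>k n. shift_poly p (\<lambda>n. complex_of_real ((Q ^^ n) x $ k)) n = 0"
    unfolding M_def complex_vec_funpow[OF lin] by (auto simp: complex_vec_def)
  have "(\<lambda>n. complex_of_real ((Q ^^ n) x \<bullet> a)) =
      (\<lambda>n. \<Sum>k\<in>UNIV. complex_of_real ((Q ^^ n) x $ k) * complex_of_real (a $ k))"
    by (simp add: inner_vec_def)
  then show ?thesis using p by (auto simp: shift_poly_sum)
qed

section \<open>Exponential decay and expansive maps\<close>

definition exp_decay :: "(nat \<Rightarrow> real) \<Rightarrow> bool" where
  "exp_decay x \<longleftrightarrow> (\<exists>c r. 0 \<le> c \<and> 0 < r \<and> r < 1 \<and> (\<forall>n. x n \<le> c * r ^ n))"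

lemma exp_decay_affine:
  assumes t: "exp_decay t" and a: "0 \<le> a" "a < 1" and x: "\<And>n. x (Suc n) \<le> a * x n + t n"
  shows "exp_decay x"
proof -
  obtain c r where c: "0 \<le> c" "0 < r" "r < 1" "\<And>n. t n \<le> c * r ^ n"
    using t by (auto simp: exp_decay_def)
  \<comment> \<open>Choosing q strictly above a leaves a gap q - a that absorbs the forcing term: C
    is so large that c is at most C * (q - a), and a * C + C * (q - a) = C * q closes the
    induction.\<close>
  obtain q where q: "max a r < q" "q < 1" using dense[of "max a r" 1] a c by auto
  define C where "C = max \<bar>x 0\<bar> (c / (q - a))"
  have C: "0 \<le> C" "x 0 \<le> C" "c \<le> C * (q - a)"
    using q by (auto simp: C_def pos_divide_le_eq[symmetric])
  have "x n \<le> C * q ^ n" for n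
  proof (induction n)
    case (Suc n)
    have "r ^ n \<le> q ^ n" using c q by (intro power_mono) auto
    then have "t n \<le> (C * (q - a)) * q ^ n"
      using mult_mono[OF C(3), of "r ^ n" "q ^ n"] c q C by (intro order_trans[OF c(4)]) auto
    moreover have "a * x n \<le> a * (C * q ^ n)" using Suc a by (intro mult_left_mono)
    ultimately have "x (Suc n) \<le> a * (C * q ^ n) + (C * (q - a)) * q ^ n"
      using x[of n] by linarith
    then show ?case by (simp add: algebra_simps)
  qed (use C in simp)
  then show ?thesis unfolding exp_decay_def using C q c by (intro exI[of _ C] exI[of _ q]) auto
qed

lemma exp_decay_Suc:
  assumes "exp_decay x" shows "exp_decay (\<lambda>n. x (Suc n))"
proof -
  obtain c r where "0 \<le> c" "0 < r" "r < 1" "\<And>n. x n \<le> c * r ^ n"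
    using assms by (auto simp: exp_decay_def)
  then show ?thesis
    unfolding exp_decay_def by (intro exI[of _ "c * r"] exI[of _ r]) (auto simp: mult.assoc simp flip: power_Suc)
qed

text \<open>A backward orbit \<open>u\<close> of \<open>v\<close> under \<open>M\<close> satisfies \<open>u (n + 1) = (u n - w (n + 1)) / l\<close>,
  where \<open>w\<close> is a backward orbit of \<open>M v - l v\<close>.\<close>

lemma backward_orbit_decay:
  fixes M :: "complex ^ 'n ^ 'n"
  assumes ev: "\<And>v l. v \<noteq> 0 \<Longrightarrow> M *v v = l *s v \<Longrightarrow> cmod l > 1"
    and u: "\<And>n. M *v u (Suc n) = u n"
  shows "exp_decay (\<lambda>n. norm (u n))"
proof -
  \<comment> \<open>All backward orbits of v are covered at once, because the induction step leaves
    \<open>u\<close> for \<open>w\<close>, a backward orbit of another vector.\<close>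
  let ?P = "\<lambda>v. \<forall>u. (\<forall>n. M *v u (Suc n) = u n) \<and> u 0 = v \<longrightarrow> exp_decay (\<lambda>n. norm (u n))"
  have "?P (u 0)"
  proof (rule eigenvalue_induct[of ?P M])
    show "?P 0"
    proof (intro allI impI)
      fix u assume u: "(\<forall>n. M *v u (Suc n) = u n) \<and> u 0 = 0"
      have "u n = 0" for n
      proof (induction n)
        case (Suc n)
        then have "M *v u (Suc n) = 0 *s u (Suc n)" using u by simp
        then show ?case using ev[of "u (Suc n)" 0] by auto
      qed (use u in simp)
      then show "exp_decay (\<lambda>n. norm (u n))"
        unfolding exp_decay_def by (intro exI[of _ 0] exI[of _ "1/2"]) auto
    qed
  next
    fix v l assume ex: "\<exists>u. u \<noteq> 0 \<and> M *v u = l *s u" and P: "?P (M *v v - l *s v)"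
    have l: "cmod l > 1" using ex ev by blast
    show "?P v"
    proof (intro allI impI)
      fix u assume u: "(\<forall>n. M *v u (Suc n) = u n) \<and> u 0 = v"
      define w where "w n = M *v u n - l *s u n" for n
      have "M *v w (Suc n) = w n" for n
        using u by (simp add: w_def matrix_vector_mult_diff_distrib vector_scalar_commute)
      then have w: "exp_decay (\<lambda>n. norm (w n))" using P u by (auto simp: w_def)
      have nl: "norm (l *s x) = cmod l * norm x" for x :: "complex ^ 'n"
        by (simp add: norm_vec_def L2_set_def norm_mult power_mult_distrib real_sqrt_mult
            flip: sum_distrib_left)
      show "exp_decay (\<lambda>n. norm (u n))"
      proof (rule exp_decay_affine)
        show "exp_decay (\<lambda>n. norm (w (Suc n)))" by (rule exp_decay_Suc[OF w])
        have "0 < cmod l" using l by linarith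
        then show "0 \<le> 1 / cmod l" "1 / cmod l < 1" using l by (simp_all add: divide_less_eq)
        fix n
        have "l *s u (Suc n) = u n - w (Suc n)" using u by (simp add: w_def)
        then have "cmod l * norm (u (Suc n)) \<le> norm (u n) + norm (w (Suc n))"
          by (metis nl norm_triangle_ineq4)
        then have "norm (u (Suc n)) \<le> (norm (u n) + norm (w (Suc n))) / cmod l"
          using l by (subst pos_le_divide_eq) (auto simp: mult.commute)
        also have "\<dots> \<le> 1 / cmod l * norm (u n) + norm (w (Suc n))"
          using l by (auto simp: add_divide_distrib divide_le_eq mult_le_cancel_left1)
        finally show "norm (u (Suc n)) \<le> 1 / cmod l * norm (u n) + norm (w (Suc n))" .
      qed
    qed
  qed
  then show ?thesis using u by blast
qed

lemma expansive_linear: "expansive Q \<Longrightarrow> linear Q"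
  by (simp add: expansive_def)

lemma expansive_bij:
  assumes "expansive Q" shows "bij Q"
proof -
  have lin: "linear Q" by (rule expansive_linear[OF assms])
  have "x = 0" if "Q x = 0" for x
  proof (rule ccontr)
    assume "x \<noteq> 0"
    then have "complex_vec x \<noteq> 0" using norm_complex_vec[of x] by auto
    moreover have "map_matrix complex_of_real (matrix Q) *v complex_vec x = 0 *s complex_vec x"
      using that lin by (simp add: complex_vec_matrix) (simp add: complex_vec_def vec_eq_iff)
    ultimately have "is_eigenvalue Q 0" unfolding is_eigenvalue_def by blast
    then show False using assms by (force simp: expansive_def)
  qed
  then have "inj Q" using lin by (simp add: linear_injective_0)
  then show ?thesis using lin by (simp add: bij_def linear_injective_imp_surjective)
qed

lemma linear_funpow: "linear f \<Longrightarrow> linear (f ^^ n)"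
  for f :: "'a::real_vector \<Rightarrow> 'a"
  by (induction n) (auto simp: linear_id linear_compose)

text \<open>Under the inverse of Q each basis vector runs through a backward orbit of the
  complexification, which decays exponentially. The slowest of these finitely many rates then serves
  for all vectors.\<close>

lemma expansive_decay:
  fixes Q :: "real ^ 'd \<Rightarrow> real ^ 'd"
  assumes Q: "expansive Q"
  shows "\<exists>c r. 0 < c \<and> 0 < r \<and> r < 1 \<and> (\<forall>n x. norm x \<le> c * r ^ n * norm ((Q ^^ n) x))"
proof -
  have lin: "linear Q" and bij: "bij Q"
    using Q expansive_linear expansive_bij by auto
  define R where "R = inv Q"
  have QR: "Q (R x) = x" "R (Q x) = x" for x using bij by (simp_all add: R_def bij_is_surj bij_is_inj surj_f_inv_f)
  have "linear R" using bij lin inj_linear_imp_inv_linear[of Q] by (simp add: R_def bij_is_inj)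
  then have linR: "linear (R ^^ n)" for n by (rule linear_funpow)
  have RQ: "(R ^^ n) ((Q ^^ n) x) = x" for n x
  proof (induction n)
    case (Suc n)
    have "(R ^^ Suc n) ((Q ^^ Suc n) x) = (R ^^ n) (R (Q ((Q ^^ n) x)))"
      by (simp only: funpow_Suc_right[of n R] funpow.simps(2)[of n Q] o_apply)
    then show ?case by (simp only: QR Suc)
  qed simp
  have "exp_decay (\<lambda>n. norm ((R ^^ n) x))" for x
  proof -
    have "exp_decay (\<lambda>n. norm (complex_vec ((R ^^ n) x)))"
    proof (rule backward_orbit_decay[where M = "map_matrix complex_of_real (matrix Q)"])
      show "cmod l > 1" if "v \<noteq> 0" "map_matrix complex_of_real (matrix Q) *v v = l *s v" for v l
        using Q that unfolding expansive_def is_eigenvalue_def by blast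
    qed (simp add: complex_vec_matrix lin QR)
    then show ?thesis by (simp add: norm_complex_vec)
  qed
  then have "\<forall>x. \<exists>c r. 0 \<le> c \<and> 0 < r \<and> r < 1 \<and> (\<forall>n. norm ((R ^^ n) x) \<le> c * r ^ n)"
    by (simp add: exp_decay_def)
  then obtain c r where c: "\<And>x. 0 \<le> c x" and r: "\<And>x. 0 < r x" "\<And>x. r x < 1"
      and cr: "\<And>x n. norm ((R ^^ n) x) \<le> c x * r x ^ n" by metis
  define B where "B = (Basis :: (real ^ 'd) set)"
  have B: "finite B" "B \<noteq> {}" by (auto simp: B_def)
  define rr where "rr = Max (r ` B)"
  have rr: "0 < rr" "rr < 1" "\<And>b. b \<in> B \<Longrightarrow> r b \<le> rr"
    using B r by (auto simp: rr_def Max_gr_iff)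
  define C where "C = (\<Sum>b\<in>B. c b) + 1"
  have "C > 0" using c by (simp add: C_def sum_nonneg add_nonneg_pos)
  moreover have "norm x \<le> C * rr ^ n * norm ((Q ^^ n) x)" for n x
  proof -
    define y where "y = (Q ^^ n) x"
    have "x = (R ^^ n) (\<Sum>b\<in>B. (y \<bullet> b) *\<^sub>R b)" 
      unfolding B_def euclidean_representation by (simp add: y_def RQ)
    also have "\<dots> = (\<Sum>b\<in>B. (y \<bullet> b) *\<^sub>R (R ^^ n) b)"
      using linR[of n] by (simp add: linear_sum linear_cmul)
    finally have "norm x \<le> (\<Sum>b\<in>B. norm ((y \<bullet> b) *\<^sub>R (R ^^ n) b))"
      by (metis norm_sum)
    also have "\<dots> \<le> (\<Sum>b\<in>B. norm y * (c b * rr ^ n))"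
    proof (rule sum_mono)
      fix b assume b: "b \<in> B"
      have "c b * r b ^ n \<le> c b * rr ^ n"
        using b r[of b] c rr by (intro mult_left_mono power_mono) (auto intro: less_imp_le)
      then have "norm ((R ^^ n) b) \<le> c b * rr ^ n" using cr[where x = b and n = n] by linarith
      moreover have "\<bar>y \<bullet> b\<bar> \<le> norm y" using b by (simp add: B_def Basis_le_norm)
      ultimately show "norm ((y \<bullet> b) *\<^sub>R (R ^^ n) b) \<le> norm y * (c b * rr ^ n)"
        by (simp add: mult_mono)
    qed
    also have "\<dots> = (C - 1) * rr ^ n * norm y"
      by (simp add: C_def sum_distrib_left sum_distrib_right mult_ac)
    also have "\<dots> \<le> C * rr ^ n * norm y" using rr by (intro mult_right_mono) auto
    finally show ?thesis by (simp add: y_def)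
  qed
  ultimately show ?thesis using rr by blast
qed

text \<open>If \<open>s (n + 1) = l * s n + t n\<close> with \<open>\<bar>l\<bar> \<ge> 1\<close>, the recurrence is solved backwards from
  the limit \<open>0\<close>, otherwise forwards.\<close>

lemma null_recurrence_decay:
  fixes p :: "complex poly"
  assumes "p \<noteq> 0" "\<And>n. shift_poly p s n = 0" "s \<longlonglongrightarrow> 0"
  shows "exp_decay (\<lambda>n. cmod (s n))"
  using assms
proof (induction "degree p" arbitrary: p s)
  case 0
  then obtain c where "p = [:c:]" "c \<noteq> 0" by (metis degree_eq_zeroE pCons_0_0)
  then have "s n = 0" for n using 0(3)[of n] by (simp add: shift_poly_def)
  then show ?case unfolding exp_decay_def by (intro exI[of _ 0] exI[of _ "1/2"]) auto
next
  case (Suc m)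
  then have "\<not> constant (poly p)" by (simp add: constant_degree)
  then obtain l where "poly p l = 0" using fundamental_theorem_of_algebra by blast
  then obtain q where q: "p = [:- l, 1:] * q" by (metis poly_eq_0_iff_dvd dvdE)
  have q0: "q \<noteq> 0" using q Suc by auto
  then have "degree p = degree [:- l, 1:] + degree q" unfolding q by (intro degree_mult_eq) auto
  then have dq: "m = degree q" using Suc(2) by simp
  define t where "t = shift_poly [:- l, 1:] s"
  have t: "t n = s (Suc n) - l * s n" for n by (simp add: t_def shift_poly_linear)
  have "(\<lambda>n. s (Suc n) - l * s n) \<longlonglongrightarrow> 0 - l * 0"
    by (intro tendsto_intros LIMSEQ_Suc[OF Suc(5)] Suc(5))
  then have "t \<longlonglongrightarrow> 0" by (simp add: t[abs_def])
  moreover have "shift_poly q t n = 0" for n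
    using Suc(4)[of n] unfolding q t_def by (simp only: shift_poly_mult[symmetric] mult.commute)
  ultimately have dec: "exp_decay (\<lambda>n. cmod (t n))" using Suc(1)[OF dq q0] by blast
  show ?case
  proof (cases "cmod l < 1")
    case True
    have "cmod (s (Suc n)) \<le> cmod l * cmod (s n) + cmod (t n)" for n
      using norm_triangle_ineq[of "l * s n" "t n"] by (simp add: t norm_mult)
    then show ?thesis using exp_decay_affine[OF dec _ True] by simp
  next
    case False
    obtain c r where c: "0 \<le> c" "0 < r" "r < 1" "\<And>n. cmod (t n) \<le> c * r ^ n"
      using dec by (auto simp: exp_decay_def)
    have step: "cmod (s n) \<le> cmod (s (Suc n)) + cmod (t n)" for n
    proof -
      have "cmod (s n) \<le> cmod (l * s n)"
        using False mult_right_mono[of 1 "cmod l" "cmod (s n)"] by (simp add: norm_mult)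
      also have "\<dots> = cmod (s (Suc n) - t n)" by (simp add: t)
      finally show ?thesis using norm_triangle_ineq4[of "s (Suc n)" "t n"] by linarith
    qed
    \<comment> \<open>The fraction is the geometric sum of the bounds on \<open>t n\<close>, ...,
      \<open>t (n + k - 1)\<close>; letting k tend to infinity removes
      \<open>s (n + k)\<close>.\<close>
    have "cmod (s n) \<le> cmod (s (n + k)) + c * r ^ n * (1 - r ^ k) / (1 - r)" for n k
    proof (induction k)
      case (Suc k)
      have "c * r ^ n * (1 - r ^ Suc k) / (1 - r) = c * r ^ n * (1 - r ^ k) / (1 - r) + c * r ^ (n + k)"
        using c by (simp add: field_simps power_add)
      then show ?case using Suc step[of "n + k"] c(4)[of "n + k"] by simp
    qed simp
    moreover have "c * r ^ n * (1 - r ^ k) / (1 - r) \<le> c * r ^ n / (1 - r)" for n k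
      using c by (intro divide_right_mono) (auto intro!: mult_left_le)
    ultimately have le: "cmod (s n) \<le> cmod (s (n + k)) + c * r ^ n / (1 - r)" for n k
      by (meson add_left_mono order_trans)
    have "cmod (s n) \<le> c * r ^ n / (1 - r)" for n
    proof (rule LIMSEQ_le_const)
      have "(\<lambda>k. cmod (s (k + n)) + c * r ^ n / (1 - r)) \<longlonglongrightarrow> cmod 0 + c * r ^ n / (1 - r)"
        by (intro tendsto_add tendsto_norm tendsto_const LIMSEQ_ignore_initial_segment[OF Suc(5)])
      then show "(\<lambda>k. cmod (s (k + n)) + c * r ^ n / (1 - r)) \<longlonglongrightarrow> c * r ^ n / (1 - r)" by simp
      show "\<exists>N. \<forall>k\<ge>N. cmod (s n) \<le> cmod (s (k + n)) + c * r ^ n / (1 - r)"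
        using le[of n] by (simp add: add.commute)
    qed
    then have "\<forall>n. cmod (s n) \<le> (c / (1 - r)) * r ^ n" by simp
    moreover have "0 \<le> c / (1 - r)" using c by simp
    ultimately show ?thesis unfolding exp_decay_def using c by blast
  qed
qed

section \<open>Distance to the nearest integer\<close>

definition int_dist :: "real \<Rightarrow> real" where
  "int_dist x = \<bar>x - of_int (round x)\<bar>"

lemma int_dist_le_half: "int_dist x \<le> 1 / 2"
  unfolding int_dist_def using of_int_round_abs_le[of x] by linarith

lemma int_dist_le: "int_dist x \<le> \<bar>x - of_int m\<bar>"
  unfolding int_dist_def using round_diff_minimal[of x m] by simp

text \<open>With \<open>e\<close> the signed distance to the nearest integer, the exponential is at
  distance 2 * |sin (pi * e)| from 1. Since |pi * e| is at most pi / 2, the continuous function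
  arcsin recovers \<open>e\<close> from this sine.\<close>

lemma int_dist_tendsto_0:
  assumes "(\<lambda>n. exp (2 * pi * \<i> * complex_of_real (s n))) \<longlonglongrightarrow> 1"
  shows "(\<lambda>n. s n - of_int (round (s n))) \<longlonglongrightarrow> 0"
proof -
  define e where "e n = s n - of_int (round (s n))" for n
  have e: "\<bar>pi * e n\<bar> \<le> pi / 2" for n
    using int_dist_le_half[of "s n"] by (simp add: e_def int_dist_def abs_mult)
  have "exp (2 * pi * \<i> * complex_of_real (s n)) = exp (\<i> * complex_of_real (2 * pi * e n))" for n
    unfolding exp_eq by (intro exI[of _ "round (s n)"]) (simp add: e_def algebra_simps)
  then have "cmod (exp (2 * pi * \<i> * complex_of_real (s n)) - 1) = 2 * \<bar>sin (pi * e n)\<bar>" for n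
    by (simp add: dist_exp_i_1 del: of_real_mult)
  moreover have "(\<lambda>n. cmod (exp (2 * pi * \<i> * complex_of_real (s n)) - 1)) \<longlonglongrightarrow> 0"
    using assms by (simp add: LIM_zero_iff tendsto_norm_zero)
  ultimately have "(\<lambda>n. (1 / 2) * (2 * \<bar>sin (pi * e n)\<bar>)) \<longlonglongrightarrow> (1 / 2) * 0"
    by (intro tendsto_mult tendsto_const) simp
  then have "(\<lambda>n. sin (pi * e n)) \<longlonglongrightarrow> 0" by (simp add: tendsto_rabs_zero_iff)
  then have "(\<lambda>n. arcsin (sin (pi * e n))) \<longlonglongrightarrow> arcsin 0"
    by (intro isCont_tendsto_compose[of 0 arcsin] isCont_arcsin) auto
  moreover have "arcsin (sin (pi * e n)) = pi * e n" for n
    using e[of n] by (intro arcsin_sin) linarith+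
  ultimately have "(\<lambda>n. (1 / pi) * (pi * e n)) \<longlonglongrightarrow> (1 / pi) * 0"
    by (intro tendsto_mult tendsto_const) simp
  then show ?thesis by (simp add: e_def)
qed

text \<open>The nearest integers satisfy the recurrence up to an error which is an integer tending to
  \<open>0\<close>, so from some index on both they and the differences to them satisfy it exactly.\<close>

lemma int_dist_summable:
  assumes p: "integer_monic p" and rec: "\<And>n. shift_poly p (\<lambda>n. complex_of_real (s n)) n = 0"
    and lim: "(\<lambda>n. exp (2 * pi * \<i> * complex_of_real (s n))) \<longlonglongrightarrow> 1"
  shows "summable (\<lambda>n. int_dist (s n))"
proof -
  define e where "e n = complex_of_real (s n - of_int (round (s n)))" for n
  have "e \<longlonglongrightarrow> of_real 0" unfolding e_def by (intro tendsto_of_real int_dist_tendsto_0 lim)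
  then have e0: "e \<longlonglongrightarrow> 0" by simp
  have "shift_poly p e n = shift_poly p (\<lambda>n. complex_of_real (s n)) n
      - shift_poly p (\<lambda>n. of_int (round (s n))) n" for n
    by (simp add: shift_poly_def e_def algebra_simps sum_subtractf)
  then have "shift_poly p e n = - shift_poly p (\<lambda>n. of_int (round (s n))) n" for n
    by (simp add: rec)
  moreover have "shift_poly p (\<lambda>n. of_int (round (s n))) n \<in> \<int>" for n
    using p by (auto simp: shift_poly_def integer_monic_def)
  ultimately have ints: "shift_poly p e n \<in> \<int>" for n by simp
  have "(\<lambda>n. shift_poly p e n) \<longlonglongrightarrow> (\<Sum>i\<le>degree p. coeff p i * 0)"
    unfolding shift_poly_def
    by (intro tendsto_sum tendsto_mult tendsto_const LIMSEQ_ignore_initial_segment[OF e0])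
  then have "\<forall>\<^sub>F n in sequentially. cmod (shift_poly p e n) < 1"
    by (intro order_tendstoD) (auto dest: tendsto_norm)
  then obtain N where N: "\<And>n. n \<ge> N \<Longrightarrow> cmod (shift_poly p e n) < 1"
    by (auto simp: eventually_sequentially)
  have "shift_poly p (\<lambda>n. e (n + N)) n = 0" for n
  proof -
    have "shift_poly p e (n + N) = 0"
      using ints[of "n + N"] N[of "n + N"] by (auto elim!: Ints_cases)
    then show ?thesis by (simp add: shift_poly_def add_ac)
  qed
  moreover have "p \<noteq> 0" using p by (auto simp: integer_monic_def)
  ultimately have "exp_decay (\<lambda>n. cmod (e (n + N)))"
    by (intro null_recurrence_decay LIMSEQ_ignore_initial_segment[OF e0])
  then obtain c r where c: "0 \<le> c" "0 < r" "r < 1" "\<And>n. cmod (e (n + N)) \<le> c * r ^ n"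
    by (auto simp: exp_decay_def)
  have "summable (\<lambda>n. cmod (e (n + N)))"
  proof (rule summable_comparison_test)
    show "summable (\<lambda>n. c * r ^ n)" using c by (intro summable_mult summable_geometric) auto
  qed (use c in auto)
  then have "summable (\<lambda>n. cmod (e n))" 
    using summable_iff_shift[of "\<lambda>n. cmod (e n)" N] by blast
  moreover have "cmod (e n) = int_dist (s n)" for n
    by (simp only: e_def norm_of_real int_dist_def)
  ultimately show ?thesis by simp
qed

section \<open>Digit expansions\<close>

lemma int_dist_nonneg: "0 \<le> int_dist x"
  by (simp add: int_dist_def)

lemma int_dist_add: "int_dist (x + y) \<le> int_dist x + int_dist y"
  using int_dist_le[of "x + y" "round x + round y"] unfolding int_dist_def by simp

lemma int_dist_minus: "int_dist (- x) = int_dist x"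
proof -
  have "int_dist (- y) \<le> int_dist y" for y
    using int_dist_le[of "- y" "- round y"] unfolding int_dist_def by simp
  from this[of x] this[of "- x"] show ?thesis by simp
qed

lemma int_dist_small: "\<bar>x\<bar> < 1 / 2 \<Longrightarrow> int_dist x = \<bar>x\<bar>"
  using round_unique'[of x 0] by (simp add: int_dist_def)

text \<open>The finite sums of \<open>(Q ^^ m) u\<close> with one digit u from U for each power m,
  of any length, in Horner form. A new digit enters at power 0, as it does when a point is traced
  back through \<open>q = Q q' + a\<close>.\<close>

inductive_set digit_sums :: "('a \<Rightarrow> 'a) \<Rightarrow> 'a::real_vector set \<Rightarrow> 'a set" for Q U where
  zero: "0 \<in> digit_sums Q U"
| step: "u \<in> U \<Longrightarrow> w \<in> digit_sums Q U \<Longrightarrow> u + Q w \<in> digit_sums Q U"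

lemma digit_sums_mono: "w \<in> digit_sums Q U \<Longrightarrow> U \<subseteq> V \<Longrightarrow> w \<in> digit_sums Q V"
  by (induction rule: digit_sums.induct) (auto intro: digit_sums.intros)

lemma digit_sums_uminus:
  assumes "linear Q" "w \<in> digit_sums Q U" shows "- w \<in> digit_sums Q (uminus ` U)"
  using assms(2)
proof (induction rule: digit_sums.induct)
  case (step u w)
  have "- (u + Q w) = - u + Q (- w)" using assms(1) by (simp add: linear_neg)
  then show ?case using step by (metis digit_sums.step imageI)
qed (simp add: digit_sums.zero)

text \<open>Subtraction digit by digit. The two sums may differ in length; \<open>0 \<in> U\<close>
  pads the shorter one, so that the digits left over, with either sign, are differences too.\<close>

lemma digit_sums_diff:
  assumes lin: "linear Q" and 0: "0 \<in> U" and w: "w \<in> digit_sums Q U" "w' \<in> digit_sums Q U"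
  shows "w - w' \<in> digit_sums Q {u - u' |u u'. u \<in> U \<and> u' \<in> U}"
  using w
proof (induction w arbitrary: w' rule: digit_sums.induct)
  case zero
  have "uminus ` U \<subseteq> {u - u' |u u'. u \<in> U \<and> u' \<in> U}"
    using 0 by (force intro: exI[of _ 0])
  then show ?case using digit_sums_mono[OF digit_sums_uminus[OF lin zero]] by simp
next
  case (step u w)
  from step(4) show ?case
  proof cases
    case zero
    have "U \<subseteq> {u - u' |u u'. u \<in> U \<and> u' \<in> U}"
      using 0 by (force intro: exI[of _ 0])
    then show ?thesis
      using digit_sums_mono[OF digit_sums.step[OF step(1,2)]] zero by simp
  next
    case w': (step u' v)
    have "(u + Q w) - w' = (u - u') + Q (w - v)" using lin w' by (simp add: linear_diff)
    moreover have "(u - u') + Q (w - v) \<in> digit_sums Q {u - u' |u u'. u \<in> U \<and> u' \<in> U}"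
      using step(1) w' step.IH[OF w'(3)] by (intro digit_sums.step) auto
    ultimately show ?thesis by (simp only:)
  qed
qed

section \<open>Phases of digit sums and separation\<close>

definition summable_phases :: "('a \<Rightarrow> 'a) \<Rightarrow> 'a::real_inner set \<Rightarrow> 'a \<Rightarrow> bool" where
  "summable_phases Q S u \<longleftrightarrow> (\<forall>a\<in>S. summable (\<lambda>n. int_dist ((Q ^^ n) u \<bullet> a)))"

lemma summable_phases_diff:
  assumes "linear Q" "summable_phases Q S u" "summable_phases Q S v"
  shows "summable_phases Q S (u - v)"
  unfolding summable_phases_def
proof
  fix a assume "a \<in> S"
  then have "summable (\<lambda>n. int_dist ((Q ^^ n) u \<bullet> a) + int_dist ((Q ^^ n) v \<bullet> a))"
    using assms by (auto simp: summable_phases_def intro: summable_add)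
  then show "summable (\<lambda>n. int_dist ((Q ^^ n) (u - v) \<bullet> a))"
  proof (rule summable_comparison_test'[of _ 0])
    fix n
    have "(Q ^^ n) (u - v) \<bullet> a = (Q ^^ n) u \<bullet> a + - ((Q ^^ n) v \<bullet> a)"
      using linear_funpow[OF assms(1), of n] by (simp add: linear_diff inner_diff_left)
    then show "norm (int_dist ((Q ^^ n) (u - v) \<bullet> a)) \<le> int_dist ((Q ^^ n) u \<bullet> a) + int_dist ((Q ^^ n) v \<bullet> a)"
      using int_dist_add[of "(Q ^^ n) u \<bullet> a" "- ((Q ^^ n) v \<bullet> a)"] by (simp add: int_dist_minus int_dist_nonneg)
  qed
qed

text \<open>The bound does not depend on the length of w: each power of Q carries a single digit,
  whose phase is dominated by the sum over the finite set U, and applying Q to the remaining digits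
  advances the tail by one index.\<close>

lemma digit_sums_phase_le:
  fixes Q :: "'a::real_inner \<Rightarrow> 'a"
  assumes lin: "linear Q" and fin: "finite U"
    and U: "\<And>u. u \<in> U \<Longrightarrow> summable (\<lambda>n. int_dist ((Q ^^ n) u \<bullet> a))" and w: "w \<in> digit_sums Q U"
  shows "int_dist ((Q ^^ N) w \<bullet> a) \<le> (\<Sum>n. \<Sum>u\<in>U. int_dist ((Q ^^ (n + N)) u \<bullet> a))"
  using w
proof (induction arbitrary: N rule: digit_sums.induct)
  define s where "s n = (\<Sum>u\<in>U. int_dist ((Q ^^ n) u \<bullet> a))" for n
  have s: "summable s" unfolding s_def by (intro summable_sum U)
  have s0: "0 \<le> s n" for n unfolding s_def by (intro sum_nonneg int_dist_nonneg)
  {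
    case zero
    have "0 \<le> (\<Sum>n. s (n + N))" using s s0 by (intro suminf_nonneg) (auto simp: summable_iff_shift)
    moreover have "(Q ^^ N) 0 = 0" using linear_funpow[OF lin] by (rule linear_0)
    ultimately show ?case by (simp add: s_def int_dist_def)
  next
    case (step u w)
    have "(Q ^^ N) (u + Q w) \<bullet> a = (Q ^^ N) u \<bullet> a + (Q ^^ Suc N) w \<bullet> a"
      using linear_funpow[OF lin, of N] by (simp add: linear_add inner_add_left funpow_swap1)
    then have "int_dist ((Q ^^ N) (u + Q w) \<bullet> a) \<le> int_dist ((Q ^^ N) u \<bullet> a) + int_dist ((Q ^^ Suc N) w \<bullet> a)"
      by (simp only: int_dist_add)
    also have "\<dots> \<le> s N + (\<Sum>n. s (n + Suc N))"
    proof (rule add_mono)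
      show "int_dist ((Q ^^ N) u \<bullet> a) \<le> s N"
        using step(1) fin unfolding s_def by (intro member_le_sum) (auto simp: int_dist_nonneg)
      show "int_dist ((Q ^^ Suc N) w \<bullet> a) \<le> (\<Sum>n. s (n + Suc N))"
        using step.IH[of "Suc N"] by (simp only: s_def)
    qed
    also have "\<dots> = (\<Sum>n. s (n + N))"
    proof -
      have "summable (\<lambda>n. s (n + N))" using s by (simp add: summable_iff_shift)
      then show ?thesis using suminf_split_head[of "\<lambda>n. s (n + N)"] by simp
    qed
    finally show ?case by (simp only: s_def)
  }
qed

text \<open>No nonzero vector can be orthogonal to a relatively dense set, hence none to a maximal
  independent subset B of it. Compactness of the unit sphere makes this quantitative.\<close>

lemma finite_separating_subset:
  fixes S :: "'a::euclidean_space set"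
  assumes "relatively_dense S"
  obtains B c where "finite B" "B \<subseteq> S" "c > 0" "\<And>x. \<exists>a\<in>B. c * norm x \<le> \<bar>x \<bullet> a\<bar>"
proof -
  obtain R where R: "R > 0" "\<And>y. \<exists>x\<in>S. dist y x < R"
    using assms by (auto simp: relatively_dense_def)
  obtain B where B: "B \<subseteq> S" "independent B" "S \<subseteq> span B"
    by (meson maximal_independent_subset)
  then have fin: "finite B" using independent_imp_finite by blast
  have sep: "\<exists>a\<in>B. x \<bullet> a \<noteq> 0" if "x \<noteq> 0" for x
  proof (rule ccontr)
    assume "\<not> ?thesis"
    then have orth: "orthogonal x s" if "s \<in> span B" for s
      using orthogonal_to_span[OF that, of x] by (auto simp: orthogonal_def)
    \<comment> \<open>The point at distance R from the hyperplane orthogonal to x; S would lie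
      inside this hyperplane and so come no closer than R.\<close>
    obtain s where s: "s \<in> S" "dist ((R / norm x) *\<^sub>R x) s < R" using R(2) by blast
    have "x \<bullet> s = 0" using orth B s by (auto simp: orthogonal_def)
    then have "x \<bullet> ((R / norm x) *\<^sub>R x - s) = R * norm x"
      using that by (simp add: inner_diff_right dot_square_norm power2_eq_square)
    moreover have "x \<bullet> ((R / norm x) *\<^sub>R x - s) \<le> norm x * norm ((R / norm x) *\<^sub>R x - s)"
      by (rule norm_cauchy_schwarz)
    moreover have "norm x * norm ((R / norm x) *\<^sub>R x - s) < norm x * R"
      using s that by (simp add: dist_norm)
    ultimately show False by (simp add: mult.commute)
  qed
  have ne: "sphere (0::'a) 1 \<noteq> {}" by (simp)
  have "continuous_on (sphere 0 1) (\<lambda>x. \<Sum>a\<in>B. \<bar>x \<bullet> a\<bar>)"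
    by (intro continuous_intros)
  then obtain x0 where x0: "x0 \<in> sphere 0 1"
      "\<And>x. x \<in> sphere 0 1 \<Longrightarrow> (\<Sum>a\<in>B. \<bar>x0 \<bullet> a\<bar>) \<le> (\<Sum>a\<in>B. \<bar>x \<bullet> a\<bar>)"
    using continuous_attains_inf[OF compact_sphere ne] by blast
  define m where "m = (\<Sum>a\<in>B. \<bar>x0 \<bullet> a\<bar>)"
  have "x0 \<noteq> 0" using x0 by auto
  then obtain a0 where a0: "a0 \<in> B" "x0 \<bullet> a0 \<noteq> 0" using sep by blast
  then have "m > 0" unfolding m_def using fin by (intro sum_pos2[of B a0]) auto
  have card: "card B > 0" using a0 fin by (auto simp: card_gt_0_iff)
  \<comment> \<open>Some summand is at least the average, which gives the constant
    \<open>m / card B\<close>.\<close>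
  have "\<exists>a\<in>B. (m / card B) * norm x \<le> \<bar>x \<bullet> a\<bar>" for x
  proof (cases "x = 0")
    case True
    then show ?thesis using a0 by auto
  next
    case False
    define y where "y = x /\<^sub>R norm x"
    have "y \<in> sphere 0 1" using False by (simp add: y_def)
    then have "m \<le> (\<Sum>a\<in>B. \<bar>y \<bullet> a\<bar>)" using x0 by (simp add: m_def)
    have "\<exists>a\<in>B. m / card B \<le> \<bar>y \<bullet> a\<bar>"
    proof (rule ccontr)
      assume "\<not> ?thesis"
      then have "(\<Sum>a\<in>B. \<bar>y \<bullet> a\<bar>) < (\<Sum>a\<in>B. m / card B)"
        using fin a0 by (intro sum_strict_mono) auto
      then show False using \<open>m \<le> _\<close> card by simp
    qed
    then obtain a where a: "a \<in> B" "m / card B \<le> \<bar>y \<bullet> a\<bar>" by blast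
    have "\<bar>y \<bullet> a\<bar> = \<bar>x \<bullet> a\<bar> / norm x" by (simp add: y_def abs_mult divide_inverse_commute)
    then have "m / card B * norm x \<le> \<bar>x \<bullet> a\<bar>" using a(2) False by (simp add: pos_le_divide_eq)
    then show ?thesis using a by blast
  qed
  then show ?thesis using that[of B "m / card B"] fin B \<open>m > 0\<close> card by simp
qed

text \<open>Iterating \<open>Q\<close> on a very small digit sum \<open>w\<close>, one reaches a vector of a prescribed small size,
  whose pairing with one of finitely many separating vectors is bounded away from the integers, while
  by summability the phases of \<open>Q\<^sup>n w\<close> are uniformly close to integers for large \<open>n\<close>.\<close>

lemma digit_sums_bounded_below:
  fixes Q :: "real ^ 'd \<Rightarrow> real ^ 'd"
  assumes Q: "expansive Q" and S: "relatively_dense S"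
    and fin: "finite U" and U: "\<And>u. u \<in> U \<Longrightarrow> summable_phases Q S u"
  shows "\<exists>e>0. \<forall>w\<in>digit_sums Q U. w \<noteq> 0 \<longrightarrow> e \<le> norm w"
proof -
  have lin: "linear Q" using Q by (rule expansive_linear)
  obtain B c where B: "finite B" "B \<subseteq> S" "c > 0" "\<And>x. \<exists>a\<in>B. c * norm x \<le> \<bar>x \<bullet> a\<bar>"
    using finite_separating_subset[OF S] by blast
  obtain K where K: "K > 0" "\<And>x. norm (Q x) \<le> K * norm x"
    using linear_bounded_pos[OF lin] by (metis mult.commute)
  define A where "A = (\<Sum>a\<in>B. norm a) + 1"
  have A: "A > 0" "\<And>a. a \<in> B \<Longrightarrow> norm a \<le> A"
  proof -
    show "A > 0" unfolding A_def by (intro add_nonneg_pos sum_nonneg) auto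
    fix a assume "a \<in> B"
    then show "norm a \<le> A" using member_le_sum[of a B norm] B by (simp add: A_def)
  qed
  \<comment> \<open>The first iterate to reach norm r has norm at most K * r, so its pairing with
    any a in B is at most K * r * A = 1 / 4. Below 1 / 2 the distance to the integers is just the
    absolute value.\<close>
  define r where "r = 1 / (4 * K * A)"
  have r: "r > 0" using K A by (simp add: r_def)
  have rKA: "K * r * A = 1 / 4" using K A by (simp add: r_def)
  have "\<exists>N. \<forall>n\<ge>N. (\<Sum>i. \<Sum>u\<in>U. int_dist ((Q ^^ (i + n)) u \<bullet> a)) < c * r" if "a \<in> B" for a
  proof -
    have "summable (\<lambda>n. \<Sum>u\<in>U. int_dist ((Q ^^ n) u \<bullet> a))"
      using U that B by (intro summable_sum) (auto simp: summable_phases_def)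
    from suminf_exist_split[OF _ this, of "c * r"] show ?thesis using B r by force
  qed
  then obtain N where N: "\<And>a n. a \<in> B \<Longrightarrow> n \<ge> N a \<Longrightarrow> (\<Sum>i. \<Sum>u\<in>U. int_dist ((Q ^^ (i + n)) u \<bullet> a)) < c * r"
    by metis
  define M where "M = (\<Sum>a\<in>B. N a)"
  have M: "N a \<le> M" if "a \<in> B" for a using that B by (auto simp: M_def intro: member_le_sum)
  have Kn: "norm ((Q ^^ n) x) \<le> K ^ n * norm x" for n x
  proof (induction n)
    case (Suc n)
    have "norm ((Q ^^ Suc n) x) \<le> K * norm ((Q ^^ n) x)" using K by simp
    also have "\<dots> \<le> K * (K ^ n * norm x)" using Suc K by (intro mult_left_mono) auto
    finally show ?case by (simp add: mult.assoc)
  qed simp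
  \<comment> \<open>Below this bound, \<open>(Q ^^ M) w\<close> is still shorter than r. The
    iterates reach norm r therefore only after index M, where the tails of the phase series are
    already smaller than c * r.\<close>
  have "r / K ^ M \<le> norm w" if w: "w \<in> digit_sums Q U" "w \<noteq> 0" for w
  proof (rule ccontr)
    assume "\<not> ?thesis"
    then have "K ^ M * norm w < r" using K by (simp add: not_le pos_less_divide_eq mult.commute)
    then have small: "norm ((Q ^^ M) w) < r" using Kn[of M w] by linarith
    obtain C q where q: "0 < C" "0 < q" "q < 1" "\<And>n x. norm x \<le> C * q ^ n * norm ((Q ^^ n) x)"
      using expansive_decay[OF Q] by blast
    have "(\<lambda>n. C * q ^ n * r) \<longlonglongrightarrow> C * 0 * r"
      using q by (intro tendsto_intros LIMSEQ_realpow_zero) auto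
    then have "\<forall>\<^sub>F n in sequentially. C * q ^ n * r < norm w"
      using w by (intro order_tendstoD) auto
    then obtain n0 where n0: "\<And>n. n \<ge> n0 \<Longrightarrow> C * q ^ n * r < norm w"
      by (auto simp: eventually_sequentially)
    have "\<exists>n\<ge>M. r \<le> norm ((Q ^^ n) w)"
    proof (rule ccontr)
      assume "\<not> ?thesis"
      then have "norm ((Q ^^ (M + n0)) w) < r" by (meson le_add1 not_le)
      then have "C * q ^ (M + n0) * norm ((Q ^^ (M + n0)) w) \<le> C * q ^ (M + n0) * r"
        using q by (intro mult_left_mono) auto
      then show False using q(4)[of w "M + n0"] n0[of "M + n0"] by linarith
    qed
    then obtain n where n: "n \<ge> M" "r \<le> norm ((Q ^^ n) w)"
        and min: "\<And>m. m < n \<Longrightarrow> \<not> (m \<ge> M \<and> r \<le> norm ((Q ^^ m) w))"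
      using exists_least_iff[of "\<lambda>n. n \<ge> M \<and> r \<le> norm ((Q ^^ n) w)"] by blast
    then have "n \<noteq> M" using small by auto
    then obtain m where m: "n = Suc m" "m \<ge> M" using n by (cases n) auto
    define z where "z = (Q ^^ n) w"
    have "norm ((Q ^^ m) w) < r" using min[of m] m by auto
    then have "K * norm ((Q ^^ m) w) \<le> K * r" using K by (intro mult_left_mono) auto
    then have z: "r \<le> norm z" "norm z \<le> K * r"
      using K(2)[of "(Q ^^ m) w"] n m by (auto simp: z_def)
    obtain a where a: "a \<in> B" "c * norm z \<le> \<bar>z \<bullet> a\<bar>" using B by blast
    have "\<bar>z \<bullet> a\<bar> \<le> norm z * norm a" by (rule Cauchy_Schwarz_ineq2)
    also have "\<dots> \<le> (K * r) * A" using z A a K r by (intro mult_mono) auto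
    finally have "int_dist (z \<bullet> a) = \<bar>z \<bullet> a\<bar>" using rKA by (intro int_dist_small) auto
    moreover have "c * r \<le> c * norm z" using z B by (intro mult_left_mono) auto
    moreover have "int_dist (z \<bullet> a) < c * r"
    proof -
      have "int_dist (z \<bullet> a) \<le> (\<Sum>i. \<Sum>u\<in>U. int_dist ((Q ^^ (i + n)) u \<bullet> a))"
        unfolding z_def
        using digit_sums_phase_le[OF lin fin _ w(1)] U a B by (auto simp: summable_phases_def)
      also have "\<dots> < c * r" using N[of a n] M[of a] a n by auto
      finally show ?thesis .
    qed
    ultimately show False using a by linarith
  qed
  moreover have "r / K ^ M > 0" using r K by simp
  ultimately show ?thesis by blast
qed

lemma finite_diffs: "finite U \<Longrightarrow> finite {u - u' |u u'. u \<in> U \<and> u' \<in> U}"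
proof -
  assume "finite U"
  then have "finite ((\<lambda>(u, u'). u - u') ` (U \<times> U))" by simp
  moreover have "{u - u' |u u'. u \<in> U \<and> u' \<in> U} = (\<lambda>(u, u'). u - u') ` (U \<times> U)" by auto
  ultimately show ?thesis by simp
qed

text \<open>A difference of two elements has the form d + v with d in a finite set, and need not
  itself be a digit sum. However, two such vectors with the same d differ by a digit sum over the
  second differences \<open>V2\<close>. Hence for each d at most one nonzero d + v can be shorter
  than e0 / 2, and its length is then the lower bound.\<close>

lemma uniform_discrete_digit_sums:
  fixes Q :: "real ^ 'd \<Rightarrow> real ^ 'd"
  assumes Q: "expansive Q" and S: "relatively_dense S"
    and U: "finite U" "0 \<in> U" "\<And>u. u \<in> U \<Longrightarrow> summable_phases Q S u"
    and C: "finite C"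
  shows "uniform_discrete {c + w |c w. c \<in> C \<and> w \<in> digit_sums Q U}"
proof -
  have lin: "linear Q" using Q by (rule expansive_linear)
  define V where "V = {u - u' |u u'. u \<in> U \<and> u' \<in> U}"
  have V: "finite V" "0 \<in> V" "\<And>v. v \<in> V \<Longrightarrow> summable_phases Q S v"
  proof -
    show "finite V" unfolding V_def by (rule finite_diffs) (rule U)
    show "0 \<in> V" using U(2) by (force simp: V_def)
    fix v assume "v \<in> V"
    then show "summable_phases Q S v" using U summable_phases_diff[OF lin] by (auto simp: V_def)
  qed
  define V2 where "V2 = {u - u' |u u'. u \<in> V \<and> u' \<in> V}"
  have "\<exists>e>0. \<forall>w\<in>digit_sums Q V2. w \<noteq> 0 \<longrightarrow> e \<le> norm w"
  proof (rule digit_sums_bounded_below[OF Q S])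
    show "finite V2" unfolding V2_def by (rule finite_diffs) (rule V)
    fix v assume "v \<in> V2"
    then show "summable_phases Q S v" using V summable_phases_diff[OF lin] by (auto simp: V2_def)
  qed
  then obtain e0 where e0: "e0 > 0" "\<And>w. w \<in> digit_sums Q V2 \<Longrightarrow> w \<noteq> 0 \<Longrightarrow> e0 \<le> norm w" by blast
  have "\<exists>e>0. \<forall>v\<in>digit_sums Q V. d + v \<noteq> 0 \<longrightarrow> e \<le> norm (d + v)" for d
  proof (cases "\<exists>v0\<in>digit_sums Q V. d + v0 \<noteq> 0 \<and> norm (d + v0) < e0 / 2")
    case True
    then obtain v0 where v0: "v0 \<in> digit_sums Q V" "d + v0 \<noteq> 0" "norm (d + v0) < e0 / 2" by blast
    have "norm (d + v0) \<le> norm (d + v)" if v: "v \<in> digit_sums Q V" for v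
    proof (rule ccontr)
      assume "\<not> ?thesis"
      then have lt: "norm (d + v) < norm (d + v0)" by simp
      have "v - v0 \<in> digit_sums Q V2" unfolding V2_def using digit_sums_diff[OF lin V(2) v v0(1)] .
      moreover have "v - v0 \<noteq> 0" using lt by auto
      ultimately have "e0 \<le> norm (v - v0)" using e0 by blast
      moreover have "norm (v - v0) \<le> norm (d + v) + norm (d + v0)"
        using norm_triangle_ineq4[of "d + v" "d + v0"] by simp
      ultimately show False using lt v0 by linarith
    qed
    then show ?thesis using v0 by (intro exI[of _ "norm (d + v0)"]) auto
  next
    case False
    then show ?thesis using e0 by (intro exI[of _ "e0 / 2"]) (auto simp: not_less)
  qed
  then obtain e where e: "\<And>d. e d > 0" 
      "\<And>d v. v \<in> digit_sums Q V \<Longrightarrow> d + v \<noteq> 0 \<Longrightarrow> e d \<le> norm (d + v)" by metis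
  \<comment> \<open>Inserting 0 keeps the set nonempty when C is empty, so that \<open>Min\<close>
    is meaningful.\<close>
  define CC where "CC = insert 0 {c - c' |c c'. c \<in> C \<and> c' \<in> C}"
  have CC: "finite (e ` CC)" "e ` CC \<noteq> {}" using finite_diffs[OF C] by (auto simp: CC_def)
  define m where "m = Min (e ` CC)"
  have m: "m > 0" "\<And>d. d \<in> CC \<Longrightarrow> m \<le> e d" using e CC by (auto simp: m_def)
  show ?thesis
    unfolding uniform_discrete_def
  proof (intro exI conjI ballI impI)
    fix x y assume "x \<in> {c + w |c w. c \<in> C \<and> w \<in> digit_sums Q U}" "y \<in> {c + w |c w. c \<in> C \<and> w \<in> digit_sums Q U}"
    then obtain c w c' w' where xy: "x = c + w" "y = c' + w'" "c \<in> C" "c' \<in> C"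
      "w \<in> digit_sums Q U" "w' \<in> digit_sums Q U" by blast
    assume d: "dist x y < m"
    have "w - w' \<in> digit_sums Q V" unfolding V_def using digit_sums_diff[OF lin U(2)] xy by blast
    moreover have "c - c' \<in> CC" using xy by (auto simp: CC_def)
    moreover have "x - y = (c - c') + (w - w')" using xy by simp
    ultimately have "x - y = 0" using e(2)[of "w - w'" "c - c'"] m(2)[of "c - c'"] d
      unfolding dist_norm by (metis not_le order_trans)
    then show "x = y" by simp
  qed (use m in auto)
qed

section \<open>Digit expansions of the points of a substitution Delone set\<close>

lemma delone_finite_Int_cball:
  fixes S :: "'a::heine_borel set"
  assumes "delone S" shows "finite (S \<inter> cball x r)"
proof -
  have "uniform_discrete (S \<inter> cball x r)"
    using assms uniform_discrete_subset[of S] by (auto simp: delone_def)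
  moreover have "bounded (S \<inter> cball x r)" by (simp add: bounded_Int)
  ultimately show ?thesis using uniform_discrete_finite_iff by blast
qed

text \<open>Following a point backwards under the substitution, it ends up in a fixed bounded region
  after finitely many steps, because \<open>Q\<close> is expansive.\<close>

lemma substitution_digit_sums:
  fixes Q :: "real ^ 'd \<Rightarrow> real ^ 'd" and \<Lambda> :: "('d::finite, 'k::finite) kset"
  assumes "substitution_delone_kset Q D \<Lambda>"
  obtains c U where "finite U" "0 \<in> U" "U \<subseteq> (\<Union>k. {p - q |p q. p \<in> \<Lambda> k \<and> q \<in> \<Lambda> k})"
    "\<And>i p. p \<in> \<Lambda> i \<Longrightarrow> p - c i \<in> digit_sums Q U"
proof -
  note sub = assms[unfolded substitution_delone_kset_def]
  have Q: "expansive Q" by (rule sub[THEN conjunct2, THEN conjunct1])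
  have finD: "finite (D i j)" for i j
    using sub[THEN conjunct2, THEN conjunct2, THEN conjunct1] by blast
  have eq: "\<Lambda> i = (\<Union>j. \<Union>a\<in>D i j. (\<lambda>x. Q x + a) ` \<Lambda> j)" for i
    by (rule sub[THEN conjunct2, THEN conjunct2, THEN conjunct2, THEN conjunct1, THEN spec])
  have del: "delone (\<Lambda> i)" for i
    using sub[THEN conjunct1] unfolding delone_kset_def by blast
  have lin: "linear Q" and bij: "bij Q" using expansive_linear[OF Q] expansive_bij[OF Q] by auto
  define R where "R = inv Q"
  have RQ: "R (Q x) = x" and QR: "Q (R x) = x" for x
    using bij by (simp_all add: R_def bij_is_surj bij_is_inj surj_f_inv_f)
  have linR: "linear R" using bij lin inj_linear_imp_inv_linear[of Q] by (simp add: R_def bij_is_inj)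
  obtain C r where r: "0 < C" "0 < r" "r < 1" "\<And>n x. norm x \<le> C * r ^ n * norm ((Q ^^ n) x)"
    using expansive_decay[OF Q] by blast
  have QRn: "(Q ^^ n) ((R ^^ n) x) = x" for n x
  proof (induction n)
    case (Suc n)
    have "(Q ^^ Suc n) ((R ^^ Suc n) x) = (Q ^^ n) (Q (R ((R ^^ n) x)))"
      by (simp only: funpow_Suc_right[of n Q] funpow.simps(2)[of n R] o_apply)
    then show ?case by (simp only: QR Suc)
  qed simp
  have dec: "norm ((R ^^ n) x) \<le> C * r ^ n * norm x" for n x
    using r(4)[of "(R ^^ n) x" n] by (simp add: QRn)
  have "\<exists>x. x \<in> \<Lambda> i" for i
    using del[of i] by (auto simp: delone_def relatively_dense_def)
  then obtain c where c: "\<And>i. c i \<in> \<Lambda> i" by metis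
  define DD where "DD = (\<Union>i j. D i j)"
  have "finite DD" using finD by (auto simp: DD_def)
  then obtain K where K: "K > 0" "\<And>a. a \<in> DD \<Longrightarrow> norm a \<le> K"
    using bounded_pos finite_imp_bounded by metis
  \<comment> \<open>The sum of the geometric series of C * r ^ k * K over positive k, which bounds
    what all translation parts accumulate along the way back; the second fact is its fixed point
    equation.\<close>
  define B where "B = C * r * K / (1 - r)"
  have B: "0 \<le> B" "r * (C * K + B) = B"
    using r K by (auto simp: B_def field_simps)
  \<comment> \<open>From \<open>q = Q q' + a\<close>, the offset of q from its base point is the
    digit \<open>Q (c l) + a - c j\<close> plus Q applied to the offset of q'. The last family holds
    the leading digits, the offsets of points in the final bounded region. Both kinds are
    differences of points of one colour, since Q maps points into \<Lambda> after adding a.\<close>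
  define U where "U = insert 0 ((\<Union>i j. (\<lambda>a. Q (c j) + a - c i) ` D i j) \<union> (\<Union>i. (\<lambda>q. q - c i) ` (\<Lambda> i \<inter> cball 0 (1 + B))))"
  have "finite (\<Lambda> i \<inter> cball 0 (1 + B))" for i
    by (rule delone_finite_Int_cball[OF del])
  then have finU: "finite U" using finD by (auto simp: U_def)
  have Lam: "Q q + a \<in> \<Lambda> i" if "q \<in> \<Lambda> j" "a \<in> D i j" for i j a q
    using that by (subst eq) blast
  have Usub: "U \<subseteq> (\<Union>k. {p - q |p q. p \<in> \<Lambda> k \<and> q \<in> \<Lambda> k})"
  proof
    fix u assume "u \<in> U"
    then consider "u = 0" | i j a where "u = Q (c j) + a - c i" "a \<in> D i j"
      | i q where "u = q - c i" "q \<in> \<Lambda> i" unfolding U_def by blast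
    then show "u \<in> (\<Union>k. {p - q |p q. p \<in> \<Lambda> k \<and> q \<in> \<Lambda> k})"
    proof cases
      case 1
      then have "u = c undefined - c undefined" by simp
      then show ?thesis using c by blast
    qed (use c Lam in blast)+
  qed
  have "p - c i \<in> digit_sums Q U" if p: "p \<in> \<Lambda> i" for i p
  proof -
    \<comment> \<open>\<open>s\<close> is the accumulated error between q and the exact preimage of
      p. It has to be controlled under all powers of R, since R itself need not be a contraction in
      the given norm; k = 0 gives the bound used in the end.\<close>
    have orbit: "\<exists>j q s. q \<in> \<Lambda> j \<and> (R ^^ n) p = q + s \<and> (\<forall>k. norm ((R ^^ k) s) \<le> B * r ^ k) \<and>
        (q - c j \<in> digit_sums Q U \<longrightarrow> p - c i \<in> digit_sums Q U)" for n
    proof (induction n)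
      case 0
      have "norm ((R ^^ k) 0) \<le> B * r ^ k" for k
        using linear_0[OF linear_funpow[OF linR, of k]] B r by simp
      then show ?case using p by (intro exI[of _ i] exI[of _ p] exI[of _ 0]) auto
    next
      case (Suc n)
      then obtain j q s where q: "q \<in> \<Lambda> j" "(R ^^ n) p = q + s" "\<And>k. norm ((R ^^ k) s) \<le> B * r ^ k"
          "q - c j \<in> digit_sums Q U \<longrightarrow> p - c i \<in> digit_sums Q U" by blast
      from q(1) have "q \<in> (\<Union>l. \<Union>a\<in>D j l. (\<lambda>x. Q x + a) ` \<Lambda> l)" by (subst (asm) eq)
      then obtain l a q' where l: "a \<in> D j l" "q' \<in> \<Lambda> l" "q = Q q' + a" by blast
      have "(R ^^ Suc n) p = q' + R (a + s)"
        using q(2) l linR by (simp add: linear_add RQ)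
      moreover have "norm ((R ^^ k) (R (a + s))) \<le> B * r ^ k" for k
      proof -
        have "(R ^^ k) (R (a + s)) = (R ^^ Suc k) a + (R ^^ Suc k) s"
          by (simp only: funpow_Suc_right[of k R] o_apply linear_add[OF linR]
              linear_add[OF linear_funpow[OF linR]])
        moreover have "norm ((R ^^ Suc k) a) \<le> C * r ^ Suc k * K"
        proof -
          have "C * r ^ Suc k * norm a \<le> C * r ^ Suc k * K"
            using l r K(2)[of a] by (intro mult_left_mono) (auto simp: DD_def)
          then show ?thesis using dec[of "Suc k" a] by linarith
        qed
        ultimately have "norm ((R ^^ k) (R (a + s))) \<le> C * r ^ Suc k * K + B * r ^ Suc k"
          using q(3)[of "Suc k"] by (metis add_mono norm_triangle_le)
        also have "\<dots> = r ^ k * (r * (C * K + B))" by (simp add: algebra_simps)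
        finally show ?thesis using B by (simp add: mult.commute)
      qed
      moreover have "q - c j \<in> digit_sums Q U" if "q' - c l \<in> digit_sums Q U"
      proof -
        have "q - c j = (Q (c l) + a - c j) + Q (q' - c l)" using l lin by (simp add: linear_diff)
        moreover have "Q (c l) + a - c j \<in> U" using l by (auto simp: U_def)
        ultimately show ?thesis using digit_sums.step that by metis
      qed
      ultimately show ?case using l q(4) by blast
    qed
    have "\<exists>n. C * r ^ n * norm p < 1"
    proof -
      have "(\<lambda>n. C * r ^ n * norm p) \<longlonglongrightarrow> C * 0 * norm p"
        using r by (intro tendsto_intros LIMSEQ_realpow_zero) auto
      then have "\<forall>\<^sub>F n in sequentially. C * r ^ n * norm p < 1" by (intro order_tendstoD) auto
      then show ?thesis by (auto simp: eventually_sequentially)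
    qed
    then obtain n where n: "C * r ^ n * norm p < 1" by blast
    obtain j q s where q: "q \<in> \<Lambda> j" "(R ^^ n) p = q + s" "\<forall>k. norm ((R ^^ k) s) \<le> B * r ^ k"
        "q - c j \<in> digit_sums Q U \<longrightarrow> p - c i \<in> digit_sums Q U" using orbit[of n] by blast
    have s: "norm s \<le> B" using spec[OF q(3), of 0] by simp
    have "norm q \<le> norm (q + s) + norm s" using norm_triangle_ineq4[of "q + s" s] by simp
    also have "\<dots> \<le> 1 + B" using q(2) dec[of n p] n s by (intro add_mono) auto
    finally have "q \<in> \<Lambda> j \<inter> cball 0 (1 + B)" using q(1) by simp
    then have "q - c j \<in> U" unfolding U_def by blast
    then have "(q - c j) + Q 0 \<in> digit_sums Q U" by (intro digit_sums.intros)
    then show ?thesis using q(4) lin by (simp add: linear_0)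
  qed
  moreover have "0 \<in> U" by (simp add: U_def)
  ultimately show ?thesis using that finU Usub by blast
qed

text \<open>The phases are controlled only within a colour. For points of different colours the
  difference of their base points is split off; these differences form the finite set
  \<open>C\<close>, and what remains is a digit sum.\<close>

lemma meyer_of_summable_phases:
  fixes Q :: "real ^ 'd \<Rightarrow> real ^ 'd" and \<Lambda> :: "('d::finite, 'k::finite) kset"
  assumes sub: "substitution_delone_kset Q D \<Lambda>" and S: "relatively_dense S"
    and ph: "\<And>k p q. p \<in> \<Lambda> k \<Longrightarrow> q \<in> \<Lambda> k \<Longrightarrow> summable_phases Q S (p - q)"
  shows "meyer (supp \<Lambda>)"
proof -
  have Q: "expansive Q"
    by (rule sub[unfolded substitution_delone_kset_def, THEN conjunct2, THEN conjunct1])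
  have del: "delone (supp \<Lambda>)"
    using sub[unfolded substitution_delone_kset_def, THEN conjunct1] unfolding delone_kset_def by blast
  have lin: "linear Q" by (rule expansive_linear[OF Q])
  obtain c U where U: "finite U" "0 \<in> U" "U \<subseteq> (\<Union>k. {p - q |p q. p \<in> \<Lambda> k \<and> q \<in> \<Lambda> k})"
    "\<And>i p. p \<in> \<Lambda> i \<Longrightarrow> p - c i \<in> digit_sums Q U"
    by (rule substitution_digit_sums[OF sub, of thesis]) blast
  have phU: "summable_phases Q S u" if "u \<in> U" for u using that U(3) ph by blast
  define V where "V = {u - u' |u u'. u \<in> U \<and> u' \<in> U}"
  define C where "C = {a - b |a b. a \<in> range c \<and> b \<in> range c}"
  have "uniform_discrete {x + w |x w. x \<in> C \<and> w \<in> digit_sums Q V}"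
  proof (rule uniform_discrete_digit_sums[OF Q S])
    show "finite V" unfolding V_def by (rule finite_diffs) (rule U)
    show "finite C" unfolding C_def by (rule finite_diffs) simp
    show "0 \<in> V" using U(2) by (force simp: V_def)
    fix v assume "v \<in> V"
    then show "summable_phases Q S v" using phU summable_phases_diff[OF lin] by (auto simp: V_def)
  qed
  moreover have "{x - y |x y. x \<in> supp \<Lambda> \<and> y \<in> supp \<Lambda>} \<subseteq> {x + w |x w. x \<in> C \<and> w \<in> digit_sums Q V}"
  proof
    fix z assume "z \<in> {x - y |x y. x \<in> supp \<Lambda> \<and> y \<in> supp \<Lambda>}"
    then obtain x y i j where z: "z = x - y" "x \<in> \<Lambda> i" "y \<in> \<Lambda> j" by (auto simp: supp_def)
    have "(x - c i) - (y - c j) \<in> digit_sums Q V"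
      unfolding V_def using digit_sums_diff[OF lin U(2) U(4) U(4)] z by blast
    moreover have "z = (c i - c j) + ((x - c i) - (y - c j))" using z by simp
    moreover have "c i - c j \<in> C" by (auto simp: C_def)
    ultimately show "z \<in> {x + w |x w. x \<in> C \<and> w \<in> digit_sums Q V}" by blast
  qed
  ultimately show ?thesis
    using del uniform_discrete_subset by (auto simp: meyer_def delone_def)
qed

section \<open>Eigenfunctions and almost periods\<close>

definition measure_preserving_map :: "'a measure \<Rightarrow> ('a \<Rightarrow> 'a) \<Rightarrow> bool" where
  "measure_preserving_map \<mu> S \<longleftrightarrow> S \<in> measurable \<mu> \<mu> \<and> distr \<mu> \<mu> S = \<mu>"

lemma measure_vimage_preserving:
  "measure_preserving_map \<mu> S \<Longrightarrow> A \<in> sets \<mu> \<Longrightarrow> measure \<mu> (S -` A \<inter> space \<mu>) = measure \<mu> A"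
  unfolding measure_preserving_map_def by (metis measure_distr)

lemma vimage_preserving_sets:
  "measure_preserving_map \<mu> S \<Longrightarrow> A \<in> sets \<mu> \<Longrightarrow> S -` A \<inter> space \<mu> \<in> sets \<mu>"
  unfolding measure_preserving_map_def by (metis measurable_sets)

lemma change_set_measurable:
  assumes "measure_preserving_map \<mu> S" "E \<in> sets \<mu>" "B \<in> sets \<mu>"
  shows "{x \<in> E. (S x \<in> B) \<noteq> (x \<in> B)} \<in> sets \<mu>"
proof -
  have "{x \<in> E. (S x \<in> B) \<noteq> (x \<in> B)} =
      E \<inter> (((S -` B \<inter> space \<mu>) - B) \<union> (B - (S -` B \<inter> space \<mu>)))"
    using sets.sets_into_space[OF assms(2)] by blast
  then show ?thesis using assms vimage_preserving_sets[OF assms(1,3)] by auto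
qed

text \<open>The substitute for continuity. Uniformity in S lets \<delta> be fixed before the map is
  known, and the restriction to E admits maps that move other points far.\<close>

definition (in Metric_space) stable_membership where
  "stable_membership \<mu> \<delta> e B \<longleftrightarrow> (\<forall>S E. measure_preserving_map \<mu> S \<and> E \<in> sets \<mu> \<and>
     (\<forall>x\<in>E. d (S x) x < \<delta>) \<longrightarrow> measure \<mu> {x \<in> E. (S x \<in> B) \<noteq> (x \<in> B)} < e)"

text \<open>For an open set \<open>U\<close> only the points of \<open>U\<close> close to its complement matter, and these sets
  shrink to the empty set; the property then passes to all sets generated by the open ones.\<close>

lemma (in Metric_space) stable_membership_exists:
  assumes "prob_space \<mu>" and sets: "sets \<mu> = sigma_sets M {U. openin mtopology U}"
    and B: "B \<in> sets \<mu>" and e: "e > (0::real)"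
  shows "\<exists>\<delta>>0. stable_membership \<mu> \<delta> e B"
proof -
  interpret prob_space \<mu> by fact
  define P where "P B \<longleftrightarrow> (\<forall>e>0. \<exists>\<delta>>0. stable_membership \<mu> \<delta> e B)" for B
  let ?G = "{U. openin mtopology U}"
  have stable: "Int_stable ?G" by (auto simp: Int_stable_def)
  have closed: "?G \<subseteq> Pow M" using openin_subset by fastforce
  have space: "space \<mu> = M"
  proof
    have "space \<mu> \<in> sigma_sets M ?G" by (metis sets sets.top)
    then show "space \<mu> \<subseteq> M" by (rule sigma_sets_into_sp[OF closed])
    have "M \<in> sets \<mu>" unfolding sets by (rule sigma_sets_top)
    then show "M \<subseteq> space \<mu>" by (rule sets.sets_into_space)
  qed
  have SM: "S x \<in> M" if "measure_preserving_map \<mu> S" "x \<in> M" for S x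
    using that measurable_space[of S \<mu> \<mu> x] space by (simp add: measure_preserving_map_def)
  have EM: "x \<in> M" if "E \<in> sets \<mu>" "x \<in> E" for E x
    using that sets.sets_into_space space by blast
  have open_sets: "U \<in> sets \<mu>" if "openin mtopology U" for U
    unfolding sets using that by (intro sigma_sets.Basic) simp
  have "P B"
    using stable closed B[unfolded sets]
  proof (induction rule: sigma_sets_induct_disjoint)
    case (basic U)
    then have U: "openin mtopology U" by simp
    define V where "V n = {x \<in> M. \<exists>y\<in>M - U. d x y < 1 / real (Suc n)}" for n
    define A where "A n = V n \<inter> U" for n
    have "V n = (\<Union>y\<in>M - U. mball y (1 / real (Suc n)))" for n
      by (auto simp: V_def commute)
    then have "openin mtopology (V n)" for n by auto
    then have A: "A n \<in> sets \<mu>" for n using U open_sets by (auto simp: A_def)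
    have "decseq A"
      unfolding decseq_Suc_iff
    proof (intro allI subsetI)
      fix n x assume "x \<in> A (Suc n)"
      moreover have "1 / real (Suc (Suc n)) \<le> 1 / real (Suc n)" by (simp add: frac_le)
      ultimately show "x \<in> A n" unfolding A_def V_def by force
    qed
    then have "(\<lambda>n. measure \<mu> (A n)) \<longlonglongrightarrow> measure \<mu> (\<Inter>n. A n)"
      using A by (intro finite_Lim_measure_decseq) auto
    moreover have "(\<Inter>n. A n) = {}"
    proof (rule equals0I)
      fix x assume x: "x \<in> (\<Inter>n. A n)"
      then have "x \<in> U" by (auto simp: A_def)
      then obtain r where r: "r > 0" "mball x r \<subseteq> U" using U by (auto simp: openin_mtopology)
      obtain n where n: "1 / real (Suc n) < r" using nat_approx_posE[OF r(1)] by blast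
      obtain y where "y \<in> M - U" "d x y < 1 / real (Suc n)" using x by (auto simp: A_def V_def)
      then have "y \<in> mball x r" using x n by (auto simp: A_def V_def)
      then show False using r \<open>y \<in> M - U\<close> by blast
    qed
    ultimately have lim: "(\<lambda>n. measure \<mu> (A n)) \<longlonglongrightarrow> 0" by simp
    show ?case
      unfolding P_def
    proof (intro allI impI)
      fix e :: real assume "e > 0"
      then have "\<forall>\<^sub>F n in sequentially. measure \<mu> (A n) < e / 2"
        using lim by (intro order_tendstoD) auto
      then obtain n where n: "measure \<mu> (A n) < e / 2" by (auto simp: eventually_sequentially)
      show "\<exists>\<delta>>0. stable_membership \<mu> \<delta> e U"
        unfolding stable_membership_def
      proof (intro exI conjI allI impI)
        fix S E assume SE: "measure_preserving_map \<mu> S \<and> E \<in> sets \<mu> \<and> (\<forall>x\<in>E. d (S x) x < 1 / real (Suc n))"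
        then have S: "measure_preserving_map \<mu> S" by blast
        \<comment> \<open>If membership changes, then whichever of x and S x lies in U is close to
          the complement. S preserves the measure, so either possibility costs at most the measure
          of A n, which is below e / 2.\<close>
        have "{x \<in> E. (S x \<in> U) \<noteq> (x \<in> U)} \<subseteq> A n \<union> (S -` A n \<inter> space \<mu>)"
        proof
          fix x assume x: "x \<in> {x \<in> E. (S x \<in> U) \<noteq> (x \<in> U)}"
          then have xM: "x \<in> M" "S x \<in> M" using SE EM SM by auto
          have dx: "d (S x) x < 1 / real (Suc n)" "d x (S x) < 1 / real (Suc n)"
            using SE x by (auto simp: commute)
          show "x \<in> A n \<union> (S -` A n \<inter> space \<mu>)"
          proof (cases "x \<in> U")
            case True
            then have "S x \<in> M - U" using x xM by auto
            then have "x \<in> A n" using True xM dx unfolding A_def V_def by blast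
            then show ?thesis by blast
          next
            case False
            then have "S x \<in> U" "x \<in> M - U" using x xM by auto
            then have "S x \<in> A n" using xM dx unfolding A_def V_def by blast
            then show ?thesis using xM space by blast
          qed
        qed
        then have "measure \<mu> {x \<in> E. (S x \<in> U) \<noteq> (x \<in> U)} \<le> measure \<mu> (A n \<union> (S -` A n \<inter> space \<mu>))"
          using A vimage_preserving_sets[OF S A] by (intro finite_measure_mono) auto
        also have "\<dots> \<le> measure \<mu> (A n) + measure \<mu> (S -` A n \<inter> space \<mu>)"
          using A vimage_preserving_sets[OF S A] by (intro measure_Un_le) auto
        also have "\<dots> < e" using n measure_vimage_preserving[OF S A, of n] by simp
        finally show "measure \<mu> {x \<in> E. (S x \<in> U) \<noteq> (x \<in> U)} < e" .
      qed simp
    qed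
  next
    case empty
    show ?case unfolding P_def stable_membership_def by (auto intro: exI[of _ 1])
  next
    case (compl B)
    have "{x \<in> E. (S x \<in> M - B) \<noteq> (x \<in> M - B)} = {x \<in> E. (S x \<in> B) \<noteq> (x \<in> B)}"
      if "measure_preserving_map \<mu> S" "E \<in> sets \<mu>" for S E
      using that SM[of S] EM[of E] by auto
    note eq = this
    show ?case
      unfolding P_def
    proof (intro allI impI)
      fix e :: real assume "e > 0"
      then obtain \<delta> where "\<delta> > 0" "stable_membership \<mu> \<delta> e B"
        using compl(2) unfolding P_def by blast
      note \<delta> = this
      show "\<exists>\<delta>>0. stable_membership \<mu> \<delta> e (M - B)"
        unfolding stable_membership_def
      proof (intro exI conjI allI impI)
        fix S E assume SE: "measure_preserving_map \<mu> S \<and> E \<in> sets \<mu> \<and> (\<forall>x\<in>E. d (S x) x < \<delta>)"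
        then have S: "measure_preserving_map \<mu> S" and E: "E \<in> sets \<mu>" by blast+
        show "measure \<mu> {x \<in> E. (S x \<in> M - B) \<noteq> (x \<in> M - B)} < e"
          unfolding eq[OF S E] using \<delta>(2) SE unfolding stable_membership_def by blast
      qed (rule \<delta>(1))
    qed
  next
    case (union A)
    have A: "A i \<in> sets \<mu>" for i using union(2) unfolding sets by blast
    define R where "R n = (\<Union>i\<in>{n..}. A i)" for n
    have R: "R n \<in> sets \<mu>" for n using A by (auto simp: R_def)
    have "decseq R" unfolding decseq_Suc_iff R_def by (intro allI UN_mono) auto
    then have "(\<lambda>n. measure \<mu> (R n)) \<longlonglongrightarrow> measure \<mu> (\<Inter>n. R n)"
      using R by (intro finite_Lim_measure_decseq) auto
    moreover have "(\<Inter>n. R n) = {}"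
    \<comment> \<open>Disjointness is what makes the tails shrink to the empty set: a point of A i
      lies in no later A j.\<close>
    proof (rule equals0I)
      fix x assume x: "x \<in> (\<Inter>n. R n)"
      then obtain i where i: "x \<in> A i" by (auto simp: R_def)
      obtain j where j: "j \<ge> Suc i" "x \<in> A j" using x by (auto simp: R_def)
      have "A i \<inter> A j = {}" using union(1) j(1) unfolding disjoint_family_on_def by auto
      then show False using i j by blast
    qed
    ultimately have lim: "(\<lambda>n. measure \<mu> (R n)) \<longlonglongrightarrow> 0" by simp
    show ?case
      unfolding P_def
    proof (intro allI impI)
      fix e :: real assume e: "e > 0"
      then have "\<forall>\<^sub>F n in sequentially. measure \<mu> (R n) < e / 4"
        using lim by (intro order_tendstoD) auto
      then obtain N where N: "measure \<mu> (R N) < e / 4" by (auto simp: eventually_sequentially)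
      \<comment> \<open>The N leading sets together cost at most e / 2. The tail is counted for x
        and again for S x, hence its bound e / 4.\<close>
      define e' where "e' = e / (2 * real (Suc N))"
      have "e' > 0" using e by (simp add: e'_def)
      then have "\<forall>i. \<exists>\<delta>>0. stable_membership \<mu> \<delta> e' (A i)"
        using union(3) unfolding P_def by blast
      then obtain \<delta> where \<delta>: "\<And>i. \<delta> i > 0" "\<And>i. stable_membership \<mu> (\<delta> i) e' (A i)"
        by metis
      define \<delta>' where "\<delta>' = Min (\<delta> ` {..N})"
      have \<delta>': "\<delta>' > 0" "\<And>i. i \<le> N \<Longrightarrow> \<delta>' \<le> \<delta> i" using \<delta>(1) by (auto simp: \<delta>'_def)
      show "\<exists>\<delta>>0. stable_membership \<mu> \<delta> e (\<Union>i. A i)"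
        unfolding stable_membership_def
      proof (intro exI conjI allI impI)
        fix S E assume SE: "measure_preserving_map \<mu> S \<and> E \<in> sets \<mu> \<and> (\<forall>x\<in>E. d (S x) x < \<delta>')"
        then have S: "measure_preserving_map \<mu> S" and E: "E \<in> sets \<mu>" by auto
        define G where "G i = {x \<in> E. (S x \<in> A i) \<noteq> (x \<in> A i)}" for i
        have G: "G i \<in> sets \<mu>" for i unfolding G_def by (rule change_set_measurable[OF S E A])
        have Ge: "measure \<mu> (G i) \<le> e'" if "i < N" for i
        proof -
          have "\<forall>x\<in>E. d (S x) x < \<delta> i" using SE \<delta>'(2)[of i] that by fastforce
          then show ?thesis using \<delta>(2)[of i] S E unfolding G_def stable_membership_def
            by (blast intro: less_imp_le)
        qed
        let ?R = "R N \<union> (S -` R N \<inter> space \<mu>)"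
        have "{x \<in> E. (S x \<in> (\<Union>i. A i)) \<noteq> (x \<in> (\<Union>i. A i))} \<subseteq> (\<Union>i<N. G i) \<union> ?R"
        proof
          fix x assume x: "x \<in> {x \<in> E. (S x \<in> (\<Union>i. A i)) \<noteq> (x \<in> (\<Union>i. A i))}"
          then have xM: "x \<in> space \<mu>" using E EM space by auto
          from x obtain i where i: "(S x \<in> A i) \<noteq> (x \<in> A i)" "S x \<in> A i \<or> x \<in> A i" by blast
          show "x \<in> (\<Union>i<N. G i) \<union> ?R"
          proof (cases "i < N")
            case True
            then show ?thesis using x i by (auto simp: G_def)
          next
            case False
            then show ?thesis using i xM by (auto simp: R_def not_less)
          qed
        qed
        then have "measure \<mu> {x \<in> E. (S x \<in> (\<Union>i. A i)) \<noteq> (x \<in> (\<Union>i. A i))} \<le> measure \<mu> ((\<Union>i<N. G i) \<union> ?R)"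
          using G R vimage_preserving_sets[OF S R] by (intro finite_measure_mono) auto
        also have "\<dots> \<le> measure \<mu> (\<Union>i<N. G i) + measure \<mu> ?R"
          using G R vimage_preserving_sets[OF S R] by (intro measure_Un_le) auto
        also have "measure \<mu> ?R \<le> measure \<mu> (R N) + measure \<mu> (S -` R N \<inter> space \<mu>)"
          using R vimage_preserving_sets[OF S R] by (intro measure_Un_le) auto
        also have "\<dots> < e / 2" using N measure_vimage_preserving[OF S R, of N] by simp
        also have "measure \<mu> (\<Union>i<N. G i) \<le> (\<Sum>i<N. measure \<mu> (G i))"
          using G by (intro measure_UNION_le) auto
        also have "\<dots> \<le> (\<Sum>i<N. e')" by (intro sum_mono Ge) auto
        also have "\<dots> \<le> e / 2" using e by (simp add: e'_def field_simps)
        finally show "measure \<mu> {x \<in> E. (S x \<in> (\<Union>i. A i)) \<noteq> (x \<in> (\<Union>i. A i))} < e" by simp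
      qed (rule \<delta>')
    qed
  qed
  then show ?thesis using e unfolding P_def by blast
qed

text \<open>The circle is covered by finitely many small discs. When \<open>z n\<close> is not close to \<open>1\<close>, the map
  \<open>T n\<close> takes any point where \<open>sgn f\<close> lies in a small disc to a point where it does not, so the set
  \<open>E\<close> of points hardly moved by \<open>T n\<close> meets \<open>{f \<noteq> 0}\<close> in a set of small measure; on the other hand
  boundedly many copies of that set cover \<open>{f \<noteq> 0}\<close>.\<close>

lemma (in Metric_space) eigenvalue_phase_tendsto_1:
  fixes f :: "'a \<Rightarrow> complex" and z :: "nat \<Rightarrow> complex"
  assumes "prob_space \<mu>" and sets: "sets \<mu> = sigma_sets M {U. openin mtopology U}"
    and f: "f \<in> borel_measurable \<mu>" "\<not> (AE x in \<mu>. f x = 0)"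
    and T: "\<And>n. measure_preserving_map \<mu> (T n)" "\<And>n. AE x in \<mu>. f (T n x) = z n * f x"
    and z: "\<And>n. cmod (z n) = 1"
    and meas: "\<And>n \<delta>. {x \<in> space \<mu>. d (T n x) x < \<delta>} \<in> sets \<mu>"
    and H: "\<And>h. h \<in> H \<Longrightarrow> measure_preserving_map \<mu> h"
      "\<And>h. h \<in> H \<Longrightarrow> AE x in \<mu>. f (h x) = 0 \<longleftrightarrow> f x = 0"
    and cover: "\<And>\<delta>. \<delta> > 0 \<Longrightarrow> \<forall>\<^sub>F n in sequentially. \<exists>Y\<subseteq>H. finite Y \<and> card Y \<le> N \<and>
      (\<forall>x\<in>space \<mu>. \<exists>h\<in>Y. d (T n (h x)) (h x) < \<delta>)"
  shows "z \<longlonglongrightarrow> 1"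
proof (rule tendstoI)
  interpret prob_space \<mu> by fact
  fix \<epsilon> :: real assume "\<epsilon> > 0"
  define F0 where "F0 = {x \<in> space \<mu>. f x \<noteq> 0}"
  have F0: "F0 \<in> sets \<mu>" unfolding F0_def using f(1) by measurable
  have "measure \<mu> F0 \<noteq> 0"
  proof
    assume "measure \<mu> F0 = 0"
    then have "AE x in \<mu>. x \<notin> F0" using F0 by (intro AE_not_in null_setsI) (auto simp: emeasure_eq_measure)
    then show False using f(2) by (auto simp: F0_def elim!: AE_mp intro!: AE_I2)
  qed
  then have m0: "measure \<mu> F0 > 0" using measure_nonneg[of \<mu> F0] by linarith
  obtain K where K: "finite K" "sphere (0::complex) 1 \<subseteq> (\<Union>b\<in>K. ball b (\<epsilon> / 2))"
  proof -
    have "sphere (0::complex) 1 \<subseteq> (\<Union>b\<in>sphere 0 1. ball b (\<epsilon> / 2))" using \<open>\<epsilon> > 0\<close> by force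
    then obtain K where "K \<subseteq> sphere (0::complex) 1" "finite K" "sphere (0::complex) 1 \<subseteq> (\<Union>b\<in>K. ball b (\<epsilon> / 2))"
      by (rule compactE_image[OF compact_sphere, rotated]) auto
    then show ?thesis using that by blast
  qed
  \<comment> \<open>The modulus of f may vary, but T n multiplies \<open>sgn f\<close> by z n almost
    everywhere. The radius \<epsilon> / 2 makes the diameter of a disc too small for it to contain a
    unit vector together with its image when z n is at least \<epsilon> away from 1.\<close>
  define B where "B b = {x \<in> space \<mu>. f x \<noteq> 0 \<and> dist b (sgn (f x)) < \<epsilon> / 2}" for b
  have sgn_meas: "(\<lambda>x. sgn (f x)) \<in> borel_measurable \<mu>"
    unfolding sgn_div_norm using f(1) by measurable
  have B: "B b \<in> sets \<mu>" for b
    unfolding B_def using f(1) sgn_meas by measurable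
  \<comment> \<open>The final count gives N * card K * \<eta> as an upper bound for the measure of
    F0, which the two successors make strictly too small. As \<delta> is chosen after \<eta>, the
    bound N must serve for all \<delta>.\<close>
  define \<eta> where "\<eta> = measure \<mu> F0 / (real (Suc N) * real (Suc (card K)))"
  have "\<eta> > 0" using m0 by (simp add: \<eta>_def)
  then have "\<forall>b. \<exists>\<delta>>0. stable_membership \<mu> \<delta> \<eta> (B b)"
    using stable_membership_exists[OF \<open>prob_space \<mu>\<close> sets B] by blast
  then obtain \<delta> where \<delta>: "\<And>b. \<delta> b > 0" "\<And>b. stable_membership \<mu> (\<delta> b) \<eta> (B b)"
    by metis
  define \<delta>' where "\<delta>' = Min (insert 1 (\<delta> ` K))"
  have \<delta>': "\<delta>' > 0" "\<And>b. b \<in> K \<Longrightarrow> \<delta>' \<le> \<delta> b" using \<delta>(1) K by (auto simp: \<delta>'_def)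
  show "\<forall>\<^sub>F n in sequentially. dist (z n) 1 < \<epsilon>"
    using cover[OF \<delta>'(1)]
  proof eventually_elim
    case (elim n)
    then obtain Y where Y: "Y \<subseteq> H" "finite Y" "card Y \<le> N"
        "\<And>x. x \<in> space \<mu> \<Longrightarrow> \<exists>h\<in>Y. d (T n (h x)) (h x) < \<delta>'" by blast
    define E where "E = {x \<in> space \<mu>. d (T n x) x < \<delta>'}"
    have E: "E \<in> sets \<mu>" unfolding E_def by (rule meas)
    show ?case
    proof (rule ccontr)
      assume far: "\<not> dist (z n) 1 < \<epsilon>"
      have "measure \<mu> (E \<inter> B b) \<le> \<eta>" if "b \<in> K" for b
      proof -
        have "measure \<mu> (E \<inter> B b) \<le> measure \<mu> {x \<in> E. (T n x \<in> B b) \<noteq> (x \<in> B b)}"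
        proof (rule finite_measure_mono_AE)
          show "AE x in \<mu>. x \<in> E \<inter> B b \<longrightarrow> x \<in> {x \<in> E. (T n x \<in> B b) \<noteq> (x \<in> B b)}"
            using T(2)[of n]
          proof eventually_elim
            case (elim x)
            show ?case
            proof
              assume x: "x \<in> E \<inter> B b"
              have "T n x \<notin> B b"
              proof
                assume Tx: "T n x \<in> B b"
                have "sgn (f (T n x)) = z n * sgn (f x)"
                  by (simp add: elim sgn_mult) (simp add: sgn_div_norm z)
                then have 1: "dist b (z n * sgn (f x)) < \<epsilon> / 2" using Tx by (simp add: B_def)
                have 2: "dist b (sgn (f x)) < \<epsilon> / 2" using x by (simp add: B_def)
                have "dist (z n * sgn (f x)) (sgn (f x)) < \<epsilon>"
                  using dist_triangle_half_r[OF 1 2] .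
                moreover have "dist (z n * sgn (f x)) (sgn (f x)) = dist (z n) 1"
                proof -
                  have "z n * sgn (f x) - sgn (f x) = (z n - 1) * sgn (f x)" by (simp add: algebra_simps)
                  moreover have "cmod (sgn (f x)) = 1" using x by (simp add: B_def norm_sgn)
                  ultimately show ?thesis by (simp add: dist_norm norm_mult)
                qed
                ultimately show False using far by simp
              qed
              then show "x \<in> {x \<in> E. (T n x \<in> B b) \<noteq> (x \<in> B b)}" using x by simp
            qed
          qed
          show "{x \<in> E. (T n x \<in> B b) \<noteq> (x \<in> B b)} \<in> sets \<mu>"
            by (rule change_set_measurable[OF T(1) E B])
        qed
        also have "\<dots> < \<eta>"
        proof -
          have "\<forall>x\<in>E. d (T n x) x < \<delta> b" using \<delta>'(2)[OF that] by (auto simp: E_def)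
          then show ?thesis using \<delta>(2)[of b] T(1)[of n] E unfolding stable_membership_def by blast
        qed
        finally show ?thesis by simp
      qed
      note small = this
      have "E \<inter> F0 \<subseteq> (\<Union>b\<in>K. E \<inter> B b)"
      proof
        fix x assume x: "x \<in> E \<inter> F0"
        then have "sgn (f x) \<in> sphere 0 1" by (simp add: F0_def norm_sgn)
        then obtain b where "b \<in> K" "sgn (f x) \<in> ball b (\<epsilon> / 2)" using K(2) by blast
        then show "x \<in> (\<Union>b\<in>K. E \<inter> B b)" using x by (auto simp: B_def F0_def)
      qed
      then have "measure \<mu> (E \<inter> F0) \<le> measure \<mu> (\<Union>b\<in>K. E \<inter> B b)"
        using E B K by (intro finite_measure_mono) auto
      also have "\<dots> \<le> (\<Sum>b\<in>K. measure \<mu> (E \<inter> B b))"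
        using E B K by (intro measure_UNION_le) auto
      also have "\<dots> \<le> (\<Sum>b\<in>K. \<eta>)" by (intro sum_mono small)
      finally have EF: "measure \<mu> (E \<inter> F0) \<le> card K * \<eta>" by simp
      \<comment> \<open>Pulling back along h preserves the measure and, up to a null set, the set
        F0, so every piece of the covering has the measure of E \<inter> F0.\<close>
      have piece: "measure \<mu> ((h -` E \<inter> space \<mu>) \<inter> F0) = measure \<mu> (E \<inter> F0)" if "h \<in> Y" for h
      proof -
        have h: "measure_preserving_map \<mu> h" "AE x in \<mu>. f (h x) = 0 \<longleftrightarrow> f x = 0" using H Y that by auto
        have hs: "h x \<in> space \<mu>" if "x \<in> space \<mu>" for x
          using h(1) that by (auto simp: measure_preserving_map_def measurable_space)
        have EF0: "E \<inter> F0 \<in> sets \<mu>" using E F0 by auto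
        have "measure \<mu> ((h -` E \<inter> space \<mu>) \<inter> F0) = measure \<mu> (h -` (E \<inter> F0) \<inter> space \<mu>)"
        proof (rule measure_eq_AE)
          show "AE x in \<mu>. x \<in> (h -` E \<inter> space \<mu>) \<inter> F0 \<longleftrightarrow> x \<in> h -` (E \<inter> F0) \<inter> space \<mu>"
            using h(2) by eventually_elim (auto simp: F0_def hs)
        qed (use vimage_preserving_sets[OF h(1) E] vimage_preserving_sets[OF h(1) EF0] F0 in auto)
        also have "\<dots> = measure \<mu> (E \<inter> F0)" by (rule measure_vimage_preserving[OF h(1) EF0])
        finally show ?thesis .
      qed
      have pm: "(h -` E \<inter> space \<mu>) \<inter> F0 \<in> sets \<mu>" if "h \<in> Y" for h
        using vimage_preserving_sets[OF H(1) E, of h] F0 Y that by auto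
      have "F0 \<subseteq> (\<Union>h\<in>Y. (h -` E \<inter> space \<mu>) \<inter> F0)"
      proof
        fix x assume x: "x \<in> F0"
        then have xs: "x \<in> space \<mu>" by (simp add: F0_def)
        then obtain h where h: "h \<in> Y" "d (T n (h x)) (h x) < \<delta>'" using Y by blast
        then have "measure_preserving_map \<mu> h" using H Y by blast
        then have "h x \<in> space \<mu>" using xs by (auto simp: measure_preserving_map_def measurable_space)
        then show "x \<in> (\<Union>h\<in>Y. (h -` E \<inter> space \<mu>) \<inter> F0)" using h x xs by (auto simp: E_def)
      qed
      then have "measure \<mu> F0 \<le> measure \<mu> (\<Union>h\<in>Y. (h -` E \<inter> space \<mu>) \<inter> F0)"
        using pm Y(2) by (intro finite_measure_mono sets.finite_UN)
      also have "\<dots> \<le> (\<Sum>h\<in>Y. measure \<mu> ((h -` E \<inter> space \<mu>) \<inter> F0))"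
        using pm Y by (intro measure_UNION_le) auto
      also have "\<dots> = card Y * measure \<mu> (E \<inter> F0)" using piece by simp
      also have "\<dots> \<le> real N * (card K * \<eta>)" using EF Y by (intro mult_mono) auto
      also have "\<dots> < real (Suc N) * real (Suc (card K)) * \<eta>"
        using \<open>\<eta> > 0\<close> by (simp add: algebra_simps add_pos_nonneg)
      also have "\<dots> = measure \<mu> F0" by (simp add: \<eta>_def)
      finally show False by simp
    qed
  qed
qed

section \<open>Supertiles\<close>

text \<open>\<open>(Q ^^ n) v + patch Q D n i k\<close> is the set of points of colour \<open>i\<close> in the \<open>n\<close>-fold substitution
  of the point \<open>v\<close> of colour \<open>k\<close>.\<close>

primrec patch ::
  "(real ^ 'd \<Rightarrow> real ^ 'd) \<Rightarrow> ('k::finite \<Rightarrow> 'k \<Rightarrow> (real ^ 'd::finite) set) \<Rightarrow> nat \<Rightarrow> 'k \<Rightarrow> 'k \<Rightarrow> (real ^ 'd) set"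
where
  "patch Q D 0 i k = (if i = k then {0} else {})"
| "patch Q D (Suc n) i k = (\<Union>j. \<Union>a\<in>D i j. (\<lambda>b. Q b + a) ` patch Q D n j k)"

lemma finite_patch: "(\<And>i j. finite (D i j)) \<Longrightarrow> finite (patch Q D n i k)"
  by (induction n arbitrary: i) auto

lemma patch_subset:
  assumes lin: "linear Q" and eq: "\<And>i. \<Lambda> i = (\<Union>j. \<Union>a\<in>D i j. (\<lambda>x. Q x + a) ` \<Lambda> j)"
    and v: "v \<in> \<Lambda> k" and b: "b \<in> patch Q D n i k"
  shows "(Q ^^ n) v + b \<in> \<Lambda> i"
  using b
proof (induction n arbitrary: i b)
  case 0
  then show ?case using v by (auto split: if_splits)
next
  case (Suc n)
  then obtain j a b' where b: "a \<in> D i j" "b' \<in> patch Q D n j k" "b = Q b' + a" by auto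
  have "(Q ^^ n) v + b' \<in> \<Lambda> j" using Suc.IH b by blast
  then have "Q ((Q ^^ n) v + b') + a \<in> \<Lambda> i" using b(1) by (subst eq) blast
  then show ?case using b lin by (simp add: linear_add add.assoc)
qed

lemma image_funpow_prototile:
  fixes Q :: "real ^ 'd::finite \<Rightarrow> real ^ 'd"
  assumes lin: "linear Q" and A: "\<And>j. Q ` A j = (\<Union>i. {a + x |a x. a \<in> D i j \<and> x \<in> A i})"
  shows "(Q ^^ n) ` A k = (\<Union>i. \<Union>b\<in>patch Q D n i k. (+) b ` A i)"
proof (induction n)
  case 0
  show ?case by (force split: if_splits)
next
  case (Suc n)
  have "(Q ^^ Suc n) ` A k = Q ` ((Q ^^ n) ` A k)" by (auto simp: image_image)
  also have "\<dots> = (\<Union>j. \<Union>b\<in>patch Q D n j k. (\<lambda>y. Q b + y) ` (Q ` A j))"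
    unfolding Suc image_UN image_image by (simp add: linear_add[OF lin])
  also have "\<dots> = (\<Union>i. \<Union>b\<in>patch Q D (Suc n) i k. (+) b ` A i)"
    unfolding A
  proof (intro subset_antisym subsetI)
    fix y assume "y \<in> (\<Union>j. \<Union>b\<in>patch Q D n j k. (\<lambda>y. Q b + y) ` (\<Union>i. {a + x |a x. a \<in> D i j \<and> x \<in> A i}))"
    then obtain j b i a x where *: "b \<in> patch Q D n j k" "a \<in> D i j" "x \<in> A i" "y = Q b + (a + x)" by blast
    then have "Q b + a \<in> patch Q D (Suc n) i k" by auto
    moreover have "y = (Q b + a) + x" using * by (simp add: add.assoc)
    ultimately show "y \<in> (\<Union>i. \<Union>b\<in>patch Q D (Suc n) i k. (+) b ` A i)" using * by blast
  next
    fix y assume "y \<in> (\<Union>i. \<Union>b\<in>patch Q D (Suc n) i k. (+) b ` A i)"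
    then obtain i b x where *: "b \<in> patch Q D (Suc n) i k" "x \<in> A i" "y = b + x" by blast
    then obtain j a b' where "a \<in> D i j" "b' \<in> patch Q D n j k" "b = Q b' + a" by auto
    moreover have "y = Q b' + (a + x)" using * calculation by (simp add: add.assoc)
    ultimately show "y \<in> (\<Union>j. \<Union>b\<in>patch Q D n j k. (\<lambda>y. Q b + y) ` (\<Union>i. {a + x |a x. a \<in> D i j \<and> x \<in> A i}))"
      using * by blast
  qed
  finally show ?case .
qed

lemma primitive_patch_nonempty:
  fixes Q :: "real ^ 'd \<Rightarrow> real ^ 'd" and D :: "'k::finite \<Rightarrow> 'k \<Rightarrow> (real ^ 'd) set"
  assumes "primitive_substitution D"
  shows "\<exists>n. \<forall>i k. patch Q D n i k \<noteq> {}"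
proof -
  let ?S = "substitution_matrix D"
  have "patch Q D n i k \<noteq> {}" if "(((**) ?S ^^ n) (mat 1)) $ i $ k \<noteq> 0" for n i k
    using that
  proof (induction n arbitrary: i)
    case 0
    then show ?case by (auto simp: mat_def split: if_splits)
  next
    case (Suc n)
    have entry: "(X ** Y) $ i $ k = (\<Sum>j\<in>UNIV. X $ i $ j * Y $ j $ k)" for X Y :: "nat ^ 'k ^ 'k"
      by (simp add: matrix_matrix_mult_def)
    have "(\<Sum>j\<in>UNIV. ?S $ i $ j * ((((**) ?S ^^ n) (mat 1)) $ j $ k)) \<noteq> 0"
      using Suc(2) unfolding funpow.simps o_apply entry .
    then obtain j where "?S $ i $ j * ((((**) ?S ^^ n) (mat 1)) $ j $ k) \<noteq> 0"
      by (meson sum.neutral)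
    then have "D i j \<noteq> {}" "patch Q D n j k \<noteq> {}"
      using Suc.IH by (auto simp: substitution_matrix_def)
    then show ?case by auto
  qed
  then show ?thesis using assms unfolding primitive_substitution_def by blast
qed

text \<open>A finite form of the Baire category theorem: if the open set is not inside T, removing T
  leaves a nonempty open set covered by the other members.\<close>

lemma open_subset_finite_closed_Union:
  fixes O' :: "'a::topological_space set"
  assumes "finite F" "\<And>T. T \<in> F \<Longrightarrow> closed T" "open O'" "O' \<noteq> {}" "O' \<subseteq> \<Union>F"
  shows "\<exists>T\<in>F. interior T \<inter> O' \<noteq> {}"
  using assms
proof (induction F arbitrary: O' rule: finite_induct)
  case (insert T F)
  show ?case
  proof (cases "O' \<subseteq> T")
    case True
    then have "O' \<subseteq> interior T" using insert(5) by (rule interior_maximal)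
    then show ?thesis using insert(6) by blast
  next
    case False
    have "open (O' - T)" using insert(4,5) by (intro open_Diff) auto
    moreover have "O' - T \<noteq> {}" using False by blast
    moreover have "O' - T \<subseteq> \<Union>F" using insert(7) by blast
    ultimately have "\<exists>T'\<in>F. interior T' \<inter> (O' - T) \<noteq> {}" using insert(3,4) by blast
    then show ?thesis by blast
  qed
qed simp

text \<open>The functional x \<bullet> (s - t) is bounded on A and attains its maximum there.
  Equality of the translates would produce a point of A exceeding the maximum by the square of the
  norm of s - t.\<close>

lemma compact_translation_eqD:
  fixes A :: "'a::real_inner set"
  assumes "compact A" "A \<noteq> {}" "(+) s ` A = (+) t ` A"
  shows "s = t"
proof -
  have "continuous_on A (\<lambda>x. x \<bullet> (s - t))" by (intro continuous_intros)
  then obtain x where x: "x \<in> A" "\<And>y. y \<in> A \<Longrightarrow> y \<bullet> (s - t) \<le> x \<bullet> (s - t)"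
    using continuous_attains_sup[OF assms(1,2)] by blast
  have "s + x \<in> (+) t ` A" using x assms(3) by blast
  then obtain y where y: "y \<in> A" "s + x = t + y" by blast
  then have "y = x + (s - t)" by (simp add: algebra_simps)
  then have "x \<bullet> (s - t) + (s - t) \<bullet> (s - t) \<le> x \<bullet> (s - t)"
    using x(2)[OF y(1)] by (simp add: inner_add_left)
  then have "(s - t) \<bullet> (s - t) \<le> 0" by linarith
  then show ?thesis by (metis antisym inner_ge_zero inner_eq_zero_iff right_minus_eq)
qed

locale supertiles =
  fixes Q :: "real ^ 'd::finite \<Rightarrow> real ^ 'd" and D :: "'k::finite \<Rightarrow> 'k \<Rightarrow> (real ^ 'd) set"
    and \<Lambda> :: "('d, 'k) kset" and A :: "'k \<Rightarrow> (real ^ 'd) set" and \<rho> :: real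
  assumes Q: "expansive Q" and finD: "\<And>i j. finite (D i j)"
    and eq: "\<And>i. \<Lambda> i = (\<Union>j. \<Union>a\<in>D i j. (\<lambda>x. Q x + a) ` \<Lambda> j)"
    and del: "\<And>i. delone (\<Lambda> i)"
    and prim: "primitive_substitution D"
    and protoA: "prototiles Q D A"
    and til: "tiling {((+) x ` A i, i) |x i. x \<in> \<Lambda> i}"
    and rho: "\<And>i. A i \<subseteq> cball 0 \<rho>"
begin

lemma linQ: "linear Q"
  using Q by (rule expansive_linear)

lemma linQn: "linear (Q ^^ n)"
  by (rule linear_funpow[OF linQ])

lemma compact_A: "compact (A i)" and A_ne: "A i \<noteq> {}"
  and QA: "Q ` A j = (\<Union>i. {a + x |a x. a \<in> D i j \<and> x \<in> A i})"
  using protoA by (auto simp: prototiles_def)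

lemma bij_Qn: "bij (Q ^^ n)"
  using expansive_bij[OF Q] by (rule bij_fn)

text \<open>Finitely many tiles cover the unit ball, so at least one prototile has interior. By
  primitivity, a supertile of every colour contains a translate of that prototile at some level, and
  the inverse of \<open>Q ^^ n\<close> carries the open set back into A k.\<close>

lemma interior_A: "interior (A k) \<noteq> {}"
proof -
  \<comment> \<open>A tile meeting the unit ball has its reference point within 1 + \<rho>, which
    makes the family finite.\<close>
  define F where "F = {(+) x ` A i |x i. x \<in> \<Lambda> i \<inter> cball 0 (1 + \<rho>)}"
  have "F = (\<Union>i. (\<lambda>x. (+) x ` A i) ` (\<Lambda> i \<inter> cball 0 (1 + \<rho>)))" unfolding F_def by blast
  then have "finite F" using delone_finite_Int_cball[OF del] by simp
  moreover have "closed T" if "T \<in> F" for T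
    using that compact_A by (auto simp: F_def intro: compact_imp_closed compact_translation)
  moreover have "ball (0 :: real ^ 'd) 1 \<subseteq> \<Union>F"
  proof
    fix y :: "real ^ 'd" assume y: "y \<in> ball 0 1"
    have "y \<in> (\<Union>T\<in>{((+) x ` A i, i) |x i. x \<in> \<Lambda> i}. fst T)" using til by (simp add: tiling_def)
    then obtain x i where x: "x \<in> \<Lambda> i" "y \<in> (+) x ` A i" by auto
    then obtain a where a: "a \<in> A i" "y = x + a" by blast
    then have "norm a \<le> \<rho>" using rho by force
    moreover have "norm x \<le> norm y + norm a" using a norm_triangle_ineq4[of y a] by simp
    ultimately have "x \<in> \<Lambda> i \<inter> cball 0 (1 + \<rho>)" using x y by simp
    then show "y \<in> \<Union>F" using x(2) unfolding F_def by blast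
  qed
  ultimately have "\<exists>T\<in>F. interior T \<inter> ball 0 1 \<noteq> {}"
    by (intro open_subset_finite_closed_Union) auto
  then obtain T where T: "T \<in> F" "interior T \<inter> ball 0 1 \<noteq> {}" by blast
  then obtain x i where "T = (+) x ` A i" by (auto simp: F_def)
  then have T': "interior ((+) x ` A i) \<noteq> {}" using T by blast
  obtain n where n: "\<And>i k. patch Q D n i k \<noteq> {}" using primitive_patch_nonempty[OF prim] by blast
  then obtain b where b: "b \<in> patch Q D n i k" by blast
  define O' where "O' = (+) (b - x) ` interior ((+) x ` A i)"
  have O1: "open O'" unfolding O'_def by (intro open_translation) simp
  have O2: "O' \<noteq> {}" using T' by (simp add: O'_def)
  have "O' \<subseteq> (+) (b - x) ` ((+) x ` A i)" unfolding O'_def using interior_subset by (intro image_mono)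
  also have "\<dots> = (+) b ` A i" by (simp add: image_image add.assoc[symmetric])
  also have "\<dots> \<subseteq> (Q ^^ n) ` A k"
    unfolding image_funpow_prototile[where D = D, OF linQ QA] using b by blast
  finally have O3: "O' \<subseteq> (Q ^^ n) ` A k" .
  have "open ((Q ^^ n) -` O')"
    using O1 linear_continuous_on[of "Q ^^ n" UNIV] linQn by (intro open_vimage) (auto simp: linear_linear)
  moreover have "(Q ^^ n) -` O' \<subseteq> A k"
    using O3 bij_Qn[of n] by (auto simp: bij_def inj_def)
  moreover have "(Q ^^ n) -` O' \<noteq> {}"
  proof -
    obtain y where "y \<in> O'" using O2 by blast
    moreover obtain x where "y = (Q ^^ n) x" using bij_Qn[of n] by (metis bij_pointE)
    ultimately show ?thesis by blast
  qed
  ultimately show ?thesis using interior_maximal by blast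
qed

text \<open>The tile at \<open>z\<close> is covered by finitely many tiles of the supertile and has interior points, so its
  interior meets that of one of them; in a tiling the two tiles are then equal.\<close>

lemma supertile_address:
  assumes v: "v \<in> \<Lambda> k" and z: "z \<in> \<Lambda> i" and inside: "cball z \<rho> \<subseteq> (\<lambda>x. (Q ^^ n) v + x) ` ((Q ^^ n) ` A k)"
  shows "\<exists>b\<in>patch Q D n i k. z = (Q ^^ n) v + b"
proof -
  define O' where "O' = (+) z ` interior (A i)"
  have O1: "open O'" unfolding O'_def by (intro open_translation) simp
  have O2: "O' \<noteq> {}" using interior_A by (simp add: O'_def)
  have zA: "O' \<subseteq> (+) z ` A i" unfolding O'_def using interior_subset by (intro image_mono)
  then have zint: "O' \<subseteq> interior ((+) z ` A i)" using O1 by (rule interior_maximal)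
  define F where "F = {(+) ((Q ^^ n) v + b) ` A j |b j. b \<in> patch Q D n j k}"
  have "F = (\<Union>j. (\<lambda>b. (+) ((Q ^^ n) v + b) ` A j) ` patch Q D n j k)" by (auto simp: F_def)
  moreover have "finite (patch Q D n j k)" for j by (rule finite_patch) (rule finD)
  ultimately have "finite F" by simp
  moreover have "closed T" if "T \<in> F" for T
    using that compact_A by (auto simp: F_def intro: compact_imp_closed compact_translation)
  moreover have "O' \<subseteq> \<Union>F"
  proof
    fix y assume "y \<in> O'"
    then obtain a where "a \<in> A i" "y = z + a" using zA by blast
    then have "y \<in> cball z \<rho>" using rho by (force simp: dist_norm)
    then have "y \<in> (\<lambda>x. (Q ^^ n) v + x) ` (\<Union>j. \<Union>b\<in>patch Q D n j k. (+) b ` A j)"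
      using inside unfolding image_funpow_prototile[where D = D, OF linQ QA] by blast
    then obtain j b a' where "b \<in> patch Q D n j k" "a' \<in> A j" "y = ((Q ^^ n) v + b) + a'"
      by (auto simp: add.assoc)
    then show "y \<in> \<Union>F" unfolding F_def by blast
  qed
  ultimately have "\<exists>T\<in>F. interior T \<inter> O' \<noteq> {}"
    using O1 O2 by (intro open_subset_finite_closed_Union) auto
  then obtain b j where b: "b \<in> patch Q D n j k" "interior ((+) ((Q ^^ n) v + b) ` A j) \<inter> O' \<noteq> {}"
    by (auto simp: F_def)
  have "(Q ^^ n) v + b \<in> \<Lambda> j" using patch_subset[OF linQ eq v b(1)] .
  moreover have "interior ((+) ((Q ^^ n) v + b) ` A j) \<inter> interior ((+) z ` A i) \<noteq> {}" using b(2) zint by blast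
  ultimately have "((+) ((Q ^^ n) v + b) ` A j, j) = ((+) z ` A i, i)"
    using til z unfolding tiling_def by fastforce
  then have "j = i" "(+) ((Q ^^ n) v + b) ` A i = (+) z ` A i" by auto
  then have "z = (Q ^^ n) v + b" using compact_translation_eqD[OF compact_A A_ne] by blast
  then show ?thesis using b(1) \<open>j = i\<close> by blast
qed

text \<open>The patch depends only on the level and the colour, so the address b found in the
  supertile of v occurs in that of v + x as well.\<close>

lemma supertile_translate:
  assumes v: "v \<in> \<Lambda> k" "v + x \<in> \<Lambda> k" and z: "z \<in> \<Lambda> i"
    and inside: "cball z \<rho> \<subseteq> (\<lambda>x. (Q ^^ n) v + x) ` ((Q ^^ n) ` A k)"
  shows "z + (Q ^^ n) x \<in> \<Lambda> i"
proof -
  obtain b where b: "b \<in> patch Q D n i k" "z = (Q ^^ n) v + b"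
    using supertile_address[OF v(1) z inside] by blast
  have "(Q ^^ n) (v + x) + b \<in> \<Lambda> i" using patch_subset[OF linQ eq v(2) b(1)] .
  then show ?thesis using b(2) by (simp add: linear_add[OF linQn] algebra_simps)
qed

text \<open>Why N depends neither on n nor on \<delta>: after rescaling by the inverse of
  \<open>Q ^^ n\<close>, the supertile becomes the fixed tile A k, the region to be searched a fixed
  ball given by repetitivity, and the window of radius 1 / e + |\<rho>| a set as small as desired
  once n is large. One finite net of the fixed ball then works for every level.\<close>

lemma almost_period_cover:
  assumes rep: "repetitive \<Lambda>" and pq: "p \<in> \<Lambda> k" "q \<in> \<Lambda> k"
  shows "\<exists>N. \<forall>\<delta>>0. \<forall>\<^sub>F n in sequentially. \<exists>Y. finite Y \<and> card Y \<le> N \<and>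
           (\<forall>g. \<exists>y\<in>Y. kset_dist (translate ((Q ^^ n) (q - p)) (translate (g + y) \<Lambda>)) (translate (g + y) \<Lambda>) < \<delta>)"
proof -
  define x where "x = q - p"
  obtain b r where br: "r > 0" "ball b r \<subseteq> A k"
    using interior_A[of k] by (metis equals0I mem_interior)
  define G where "G i = (if i = k then {p, q} else {})" for i
  have "\<forall>i. finite (G i) \<and> G i \<subseteq> \<Lambda> i" using pq by (auto simp: G_def)
  then obtain M where M: "M > 0" "\<And>y. \<exists>t. \<forall>i. (+) t ` G i \<subseteq> \<Lambda> i \<inter> ball y M"
    using rep unfolding repetitive_def by blast
  have M': "\<exists>t. p + t \<in> \<Lambda> k \<and> q + t \<in> \<Lambda> k \<and> dist y (p + t) < M" for y
  proof -
    obtain t where "(+) t ` G k \<subseteq> \<Lambda> k \<inter> ball y M" using M(2) by blast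
    then show ?thesis by (intro exI[of _ t]) (simp add: G_def add.commute)
  qed
  \<comment> \<open>A good v lies within M of any prescribed u, so the centre v + b of the ball
    inside its tile lies within M + norm b of u. Half of r is spent on the net and half on the
    window.\<close>
  have "cball (0 :: real ^ 'd) (M + norm b) \<subseteq> (\<Union>y\<in>cball 0 (M + norm b). ball y (r / 2))"
    using br by force
  then obtain Y0 where Y0: "finite Y0" "cball (0 :: real ^ 'd) (M + norm b) \<subseteq> (\<Union>y\<in>Y0. ball y (r / 2))"
    by (rule compactE_image[OF compact_cball, rotated]) auto
  have "\<forall>\<^sub>F n in sequentially. \<exists>Y. finite Y \<and> card Y \<le> card Y0 \<and>
      (\<forall>g. \<exists>y\<in>Y. kset_dist (translate ((Q ^^ n) x) (translate (g + y) \<Lambda>)) (translate (g + y) \<Lambda>) < \<delta>)"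
    if "\<delta> > 0" for \<delta>
  proof -
    define e where "e = \<delta> / 2"
    have e: "0 < e" "e < \<delta>" using that by (auto simp: e_def)
    define L where "L = 1 / e"
    obtain C s where s: "0 < C" "0 < s" "s < 1" "\<And>n x. norm x \<le> C * s ^ n * norm ((Q ^^ n) x)"
      using expansive_decay[OF Q] by blast
    have "(\<lambda>n. C * s ^ n * (L + \<bar>\<rho>\<bar>)) \<longlonglongrightarrow> C * 0 * (L + \<bar>\<rho>\<bar>)"
      using s by (intro tendsto_intros LIMSEQ_realpow_zero) auto
    then have "\<forall>\<^sub>F n in sequentially. C * s ^ n * (L + \<bar>\<rho>\<bar>) < r / 2"
      using br by (intro order_tendstoD) auto
    then show ?thesis
    proof eventually_elim
      case (elim n)
      have small: "norm w < r / 2" if "norm ((Q ^^ n) w) \<le> L + \<bar>\<rho>\<bar>" for w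
      proof -
        have "C * s ^ n * norm ((Q ^^ n) w) \<le> C * s ^ n * (L + \<bar>\<rho>\<bar>)"
          using that s by (intro mult_left_mono) auto
        then show ?thesis using s(4)[of w n] elim by linarith
      qed
      show ?case
      proof (intro exI conjI allI)
        show "finite ((Q ^^ n) ` Y0)" using Y0 by simp
        show "card ((Q ^^ n) ` Y0) \<le> card Y0" by (rule card_image_le) (rule Y0)
        fix g
        obtain u where u: "g = (Q ^^ n) u" using bij_Qn[of n] by (metis bij_pointE)
        obtain t where t: "p + t \<in> \<Lambda> k" "q + t \<in> \<Lambda> k" "dist u (p + t) < M" using M' by blast
        define v where "v = p + t"
        have v: "v \<in> \<Lambda> k" "v + x \<in> \<Lambda> k" using t by (auto simp: v_def x_def algebra_simps)
        have "norm (v + b - u) \<le> norm (v - u) + norm b"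
          using norm_triangle_ineq[of "v - u" b] by (simp add: algebra_simps)
        also have "\<dots> \<le> M + norm b" using t(3) by (simp add: v_def dist_norm norm_minus_commute)
        finally have "v + b - u \<in> cball 0 (M + norm b)" by simp
        then obtain y where y: "y \<in> Y0" "dist y (v + b - u) < r / 2" using Y0(2) by auto
        define c where "c = g + (Q ^^ n) y"
        have inside: "c + w \<in> (\<lambda>x. (Q ^^ n) v + x) ` ((Q ^^ n) ` A k)" if "norm w \<le> L + \<bar>\<rho>\<bar>" for w
        proof -
          obtain w' where w': "w = (Q ^^ n) w'" using bij_Qn[of n] by (metis bij_pointE)
          then have "norm w' < r / 2" using small that by simp
          moreover have "u + y + w' - v - b = (y - (v + b - u)) + w'" by simp
          ultimately have "norm (u + y + w' - v - b) < r"
            using y(2) norm_triangle_ineq[of "y - (v + b - u)" w'] by (simp only: dist_norm)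
          then have "u + y + w' - v \<in> ball b r"
            by (simp add: dist_norm norm_minus_commute[of b])
          then have "u + y + w' - v \<in> A k" using br by blast
          moreover have "c + w = (Q ^^ n) v + (Q ^^ n) (u + y + w' - v)"
            by (simp add: c_def u w' linear_add[OF linQn] linear_diff[OF linQn])
          ultimately show ?thesis by blast
        qed
        have fwd: "z + (Q ^^ n) x \<in> \<Lambda> i" if "z \<in> \<Lambda> i" "norm (z - c) < L" for z i
        proof (rule supertile_translate[OF v that(1)])
          show "cball z \<rho> \<subseteq> (\<lambda>x. (Q ^^ n) v + x) ` ((Q ^^ n) ` A k)"
          proof
            fix y assume "y \<in> cball z \<rho>"
            then have "norm (y - z) \<le> \<bar>\<rho>\<bar>" by (simp add: dist_norm norm_minus_commute)
            then have "norm (y - c) \<le> L + \<bar>\<rho>\<bar>"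
              using that(2) norm_triangle_ineq[of "z - c" "y - z"] by simp
            then show "y \<in> (\<lambda>x. (Q ^^ n) v + x) ` ((Q ^^ n) ` A k)" using inside[of "y - c"] by simp
          qed
        qed
        \<comment> \<open>Closeness requires inclusions in both directions. The second one exchanges
          the two supertiles: v + x is the starting point and - x the translation.\<close>
        have bwd: "z - (Q ^^ n) x \<in> \<Lambda> i" if "z \<in> \<Lambda> i" "norm (z - (Q ^^ n) x - c) < L" for z i
        proof -
          have "z + (Q ^^ n) (- x) \<in> \<Lambda> i"
          proof (rule supertile_translate[OF v(2) _ that(1)])
            show "v + x + - x \<in> \<Lambda> k" using v by simp
            show "cball z \<rho> \<subseteq> (\<lambda>y. (Q ^^ n) (v + x) + y) ` ((Q ^^ n) ` A k)"
            proof
              fix y assume "y \<in> cball z \<rho>"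
              then have "norm (y - z) \<le> \<bar>\<rho>\<bar>" by (simp add: dist_norm norm_minus_commute)
              then have "norm (y - (Q ^^ n) x - c) \<le> L + \<bar>\<rho>\<bar>"
                using that(2) norm_triangle_ineq[of "z - (Q ^^ n) x - c" "y - z"] by (simp add: algebra_simps)
              then have "y - (Q ^^ n) x \<in> (\<lambda>x. (Q ^^ n) v + x) ` ((Q ^^ n) ` A k)"
                using inside[of "y - (Q ^^ n) x - c"] by simp
              then obtain a where "a \<in> (Q ^^ n) ` A k" "y - (Q ^^ n) x = (Q ^^ n) v + a" by blast
              then have "y = (Q ^^ n) (v + x) + a" "a \<in> (Q ^^ n) ` A k"
                by (simp_all add: linear_add[OF linQn] algebra_simps)
              then show "y \<in> (\<lambda>y. (Q ^^ n) (v + x) + y) ` ((Q ^^ n) ` A k)" by blast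
            qed
          qed
          then show ?thesis by (simp add: linear_neg[OF linQn])
        qed
        \<comment> \<open>Inside the window the two coloured sets agree exactly, so each point is
          matched with itself.\<close>
        have cw: "close_within e (translate ((Q ^^ n) x) (translate c \<Lambda>)) (translate c \<Lambda>)"
          unfolding close_within_iff
        proof (intro allI conjI ballI impI)
          fix i y assume "y \<in> translate c \<Lambda> i" "norm y < 1 / e"
          then obtain z where z: "z \<in> \<Lambda> i" "y = z - c" "norm (z - c) < L" by (auto simp: translate_def L_def)
          then have "y \<in> translate ((Q ^^ n) x) (translate c \<Lambda>) i"
            using fwd unfolding translate_def image_image by (intro image_eqI[of _ _ "z + (Q ^^ n) x"]) auto
          then show "\<exists>y'\<in>translate ((Q ^^ n) x) (translate c \<Lambda>) i. dist y' y < e"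
            using e by (intro bexI[of _ y]) auto
        next
          fix i y assume "y \<in> translate ((Q ^^ n) x) (translate c \<Lambda>) i" "norm y < 1 / e"
          then obtain z where z: "z \<in> \<Lambda> i" "y = z - c - (Q ^^ n) x" "norm (z - c - (Q ^^ n) x) < L"
            by (auto simp: translate_def L_def)
          have "norm (z - (Q ^^ n) x - c) < L" using z(3) by (simp only: diff_diff_eq add.commute)
          then have "z - (Q ^^ n) x \<in> \<Lambda> i" by (rule bwd[OF z(1)])
          then have "y \<in> translate c \<Lambda> i"
            using z unfolding translate_def by (intro image_eqI[of _ _ "z - (Q ^^ n) x"]) auto
          then show "\<exists>y'\<in>translate c \<Lambda> i. dist y' y < e"
            using e by (intro bexI[of _ y]) auto
        qed
        have "kset_dist (translate ((Q ^^ n) x) (translate c \<Lambda>)) (translate c \<Lambda>) < \<delta>"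
          unfolding kset_dist_less_iff using cw e by blast
        then show "\<exists>y\<in>(Q ^^ n) ` Y0. kset_dist (translate ((Q ^^ n) x) (translate (g + y) \<Lambda>)) (translate (g + y) \<Lambda>) < \<delta>"
          using y(1) unfolding c_def by blast
      qed
    qed
  qed
  then show ?thesis unfolding x_def by blast
qed

end

section \<open>The translation action on the hull\<close>

lemma translate_translate: "translate g (translate h \<Gamma>) = translate (h + g) \<Gamma>"
  by (simp add: translate_def image_image diff_diff_eq)

lemma close_within_translate:
  fixes \<Gamma> \<Gamma>' :: "('d::finite, 'k::finite) kset"
  assumes "close_within a \<Gamma> \<Gamma>'" and a: "0 < a" "a \<le> e" "1 / e + norm g \<le> 1 / a"
  shows "close_within e (translate g \<Gamma>) (translate g \<Gamma>')"
proof -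
  have *: "\<exists>x\<in>(\<lambda>x. x - g) ` S. dist x y < e"
    if y: "y \<in> (\<lambda>x. x - g) ` T" "norm y < 1 / e" and cl: "\<And>y. y \<in> T \<Longrightarrow> norm y < 1 / a \<Longrightarrow> \<exists>x\<in>S. dist x y < a"
    for S T :: "(real ^ 'd) set" and y
  proof -
    obtain z where z: "z \<in> T" "y = z - g" using y by blast
    have "norm z \<le> norm y + norm g" using norm_triangle_ineq[of y g] z by simp
    then have "norm z < 1 / a" using y(2) a by linarith
    then obtain x where "x \<in> S" "dist x z < a" using cl z by blast
    then show ?thesis using z a by (intro bexI[of _ "x - g"]) (auto simp: dist_norm)
  qed
  have cl: "\<And>i y. y \<in> \<Gamma>' i \<Longrightarrow> norm y < 1 / a \<Longrightarrow> \<exists>x\<in>\<Gamma> i. dist x y < a"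
    "\<And>i y. y \<in> \<Gamma> i \<Longrightarrow> norm y < 1 / a \<Longrightarrow> \<exists>x\<in>\<Gamma>' i. dist x y < a"
    using assms(1) unfolding close_within_iff by blast+
  show ?thesis
    unfolding close_within_iff translate_def
  proof (intro allI conjI ballI impI)
    fix i y assume y: "y \<in> (\<lambda>x. x - g) ` \<Gamma>' i" "norm y < 1 / e"
    show "\<exists>x\<in>(\<lambda>x. x - g) ` \<Gamma> i. dist x y < e" by (rule *[OF y cl(1)])
  next
    fix i y assume y: "y \<in> (\<lambda>x. x - g) ` \<Gamma> i" "norm y < 1 / e"
    show "\<exists>x\<in>(\<lambda>x. x - g) ` \<Gamma>' i. dist x y < e" by (rule *[OF y cl(2)])
  qed
qed

lemma kset_dist_translate_uniform:
  assumes "e > 0"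
  shows "\<exists>\<delta>>0. \<forall>\<Gamma> \<Gamma>'. kset_dist \<Gamma> \<Gamma>' < \<delta> \<longrightarrow> kset_dist (translate g \<Gamma>) (translate g \<Gamma>') < e"
proof -
  define e' where "e' = e / 2"
  have e': "0 < e'" "e' < e" using assms by (auto simp: e'_def)
  \<comment> \<open>The cap excludes the truncation value of the metric, so that a distance below
    \<delta> comes from genuine closeness. The other term makes the window wide enough to contain
    the one shifted by g.\<close>
  define \<delta> where "\<delta> = min (2 powr (-1/2)) (1 / (1 / e' + norm g))"
  have pos: "1 / e' + norm g > 0" using e' by (intro add_pos_nonneg) auto
  have \<delta>: "\<delta> > 0" using pos by (simp add: \<delta>_def)
  have "kset_dist (translate g \<Gamma>) (translate g \<Gamma>') < e" if lt: "kset_dist \<Gamma> \<Gamma>' < \<delta>" for \<Gamma> \<Gamma>'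
  proof -
    have "\<not> 2 powr (-1/2) < \<delta>" by (simp add: \<delta>_def)
    then obtain a where a: "a > 0" "a < \<delta>" "close_within a \<Gamma> \<Gamma>'"
      using lt unfolding kset_dist_less_iff by blast
    have "a \<le> 1 / (1 / e' + norm g)" using a by (simp add: \<delta>_def)
    then have le: "1 / e' + norm g \<le> 1 / a"
      using a(1) pos by (simp add: pos_le_divide_eq mult.commute)
    then have "1 / e' \<le> 1 / a" using norm_ge_zero[of g] by linarith
    then have "a \<le> e'" using a(1) e' by (simp add: field_simps)
    then have "close_within e' (translate g \<Gamma>) (translate g \<Gamma>')"
      using close_within_translate[OF a(3,1) _ le] by blast
    then show ?thesis unfolding kset_dist_less_iff using e' by blast
  qed
  then show ?thesis using \<delta> by blast
qed

lemma delone_translate: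
  fixes S :: "(real ^ 'd::finite) set"
  assumes "delone S" shows "delone ((\<lambda>x. x - g) ` S)"
proof -
  obtain R where R: "R > 0" "\<And>y. \<exists>x\<in>S. dist y x < R"
    using assms by (auto simp: delone_def relatively_dense_def)
  obtain e where e: "e > 0" "\<And>x y. x \<in> S \<Longrightarrow> y \<in> S \<Longrightarrow> dist x y < e \<Longrightarrow> x = y"
    using assms by (auto simp: delone_def uniform_discrete_def)
  have "\<exists>x\<in>(\<lambda>x. x - g) ` S. dist y x < R" for y
  proof -
    obtain x where "x \<in> S" "dist (y + g) x < R" using R by blast
    then show ?thesis by (intro bexI[of _ "x - g"]) (auto simp: dist_norm algebra_simps)
  qed
  then have "relatively_dense ((\<lambda>x. x - g) ` S)" using R(1) by (auto simp: relatively_dense_def)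
  moreover have "uniform_discrete ((\<lambda>x. x - g) ` S)"
    unfolding uniform_discrete_def using e by (intro exI[of _ e]) (auto simp: dist_norm)
  ultimately show ?thesis by (simp add: delone_def)
qed

lemma delone_kset_translate:
  assumes "delone_kset \<Gamma>" shows "delone_kset (translate g \<Gamma>)"
proof -
  have "supp (translate g \<Gamma>) = (\<lambda>x. x - g) ` supp \<Gamma>" by (auto simp: supp_def translate_def)
  moreover have "is_kset (translate g \<Gamma>)"
    using assms unfolding delone_kset_def is_kset_def translate_def by fastforce
  ultimately show ?thesis
    using assms by (simp add: delone_kset_def delone_translate) (simp add: translate_def delone_translate)
qed

lemma kset_hull_iff:
  fixes \<Lambda> :: "('d::finite, 'k::finite) kset"
  assumes "delone_kset \<Lambda>"
  shows "\<Gamma> \<in> kset_hull \<Lambda> \<longleftrightarrow> delone_kset \<Gamma> \<and> (\<forall>r>0. \<exists>g. kset_dist \<Gamma> (translate g \<Lambda>) < r)"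
proof -
  interpret Metric_space "{\<Gamma> :: ('d, 'k) kset. delone_kset \<Gamma>}" kset_dist
    by (rule Metric_space_kset_dist)
  show ?thesis
    using delone_kset_translate[OF assms]
    by (auto simp: kset_hull_def kset_topology_def metric_closure_of)
qed

lemma kset_hull_translate:
  fixes \<Lambda> :: "('d::finite, 'k::finite) kset"
  assumes "delone_kset \<Lambda>" "\<Gamma> \<in> kset_hull \<Lambda>"
  shows "translate g \<Gamma> \<in> kset_hull \<Lambda>"
proof -
  have \<Gamma>: "delone_kset \<Gamma>" "\<And>r. r > 0 \<Longrightarrow> \<exists>h. kset_dist \<Gamma> (translate h \<Lambda>) < r"
    using assms by (auto simp: kset_hull_iff)
  have "\<exists>h. kset_dist (translate g \<Gamma>) (translate h \<Lambda>) < r" if r: "r > 0" for r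
  proof -
    obtain \<delta> where "\<delta> > 0" "\<And>\<Gamma> \<Gamma>' :: ('d, 'k) kset. kset_dist \<Gamma> \<Gamma>' < \<delta> \<Longrightarrow> kset_dist (translate g \<Gamma>) (translate g \<Gamma>') < r"
      using kset_dist_translate_uniform[OF r] by blast
    moreover obtain h where "kset_dist \<Gamma> (translate h \<Lambda>) < \<delta>" using \<Gamma>(2) \<open>\<delta> > 0\<close> by blast
    ultimately have "kset_dist (translate g \<Gamma>) (translate (h + g) \<Lambda>) < r"
      by (simp only: translate_translate[symmetric])
    then show ?thesis by blast
  qed
  then show ?thesis using \<Gamma>(1) delone_kset_translate by (simp add: kset_hull_iff assms(1))
qed

text \<open>Passing from the orbit to its closure keeps the set Y and doubles the tolerance, because
  only finitely many translations, by y and by y + x with y in Y, have to be controlled by uniform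
  continuity.\<close>

lemma almost_period_cover_hull:
  fixes \<Lambda> :: "('d::finite, 'k::finite) kset"
  assumes del: "delone_kset \<Lambda>" and Y: "finite Y" and \<delta>: "\<delta> > 0"
    and orb: "\<And>g. \<exists>y\<in>Y. kset_dist (translate x (translate (g + y) \<Lambda>)) (translate (g + y) \<Lambda>) < \<delta> / 2"
    and \<Gamma>: "\<Gamma> \<in> kset_hull \<Lambda>"
  shows "\<exists>y\<in>Y. kset_dist (translate x (translate y \<Gamma>)) (translate y \<Gamma>) < \<delta>"
proof -
  have "\<delta> / 4 > 0" using \<delta> by simp
  then have "\<forall>w. \<exists>r>0. \<forall>\<Gamma> \<Gamma>'. kset_dist \<Gamma> \<Gamma>' < r \<longrightarrow> kset_dist (translate w \<Gamma>) (translate w \<Gamma>' :: ('d, 'k) kset) < \<delta> / 4"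
    using kset_dist_translate_uniform by blast
  then obtain r where r: "\<And>w. r w > 0"
      "\<And>w \<Gamma> \<Gamma>' :: ('d, 'k) kset. kset_dist \<Gamma> \<Gamma>' < r w \<Longrightarrow> kset_dist (translate w \<Gamma>) (translate w \<Gamma>') < \<delta> / 4"
    by metis
  define R where "R = Min (insert 1 (r ` (Y \<union> (\<lambda>y. y + x) ` Y)))"
  have R: "R > 0" using r(1) Y by (auto simp: R_def)
  have Rle: "R \<le> r w" if "w \<in> Y \<union> (\<lambda>y. y + x) ` Y" for w
    unfolding R_def using Y that by (intro Min_le) auto
  obtain g where g: "kset_dist \<Gamma> (translate g \<Lambda>) < R" using \<Gamma> R kset_hull_iff[OF del] by blast
  obtain y where y: "y \<in> Y" "kset_dist (translate x (translate (g + y) \<Lambda>)) (translate (g + y) \<Lambda>) < \<delta> / 2"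
    using orb by blast
  have 1: "kset_dist (translate y \<Gamma>) (translate (g + y) \<Lambda>) < \<delta> / 4"
    using r(2)[of \<Gamma> "translate g \<Lambda>" y] g Rle[of y] y(1) by (simp add: translate_translate)
  have 2: "kset_dist (translate x (translate y \<Gamma>)) (translate x (translate (g + y) \<Lambda>)) < \<delta> / 4"
    using r(2)[of \<Gamma> "translate g \<Lambda>" "y + x"] g Rle[of "y + x"] y(1) by (simp add: translate_translate add.assoc)
  have "kset_dist (translate x (translate y \<Gamma>)) (translate y \<Gamma>)
      \<le> kset_dist (translate x (translate y \<Gamma>)) (translate x (translate (g + y) \<Lambda>))
        + (kset_dist (translate x (translate (g + y) \<Lambda>)) (translate (g + y) \<Lambda>)
        + kset_dist (translate (g + y) \<Lambda>) (translate y \<Gamma>))"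
    by (meson add_left_mono kset_dist_triangle order_trans)
  then show ?thesis using 1 2 y by (intro bexI[of _ y]) (simp_all add: kset_dist_commute)
qed

lemma eigenvalue_phases_tendsto_1:
  fixes \<Lambda> :: "('d::finite, 'k::finite) kset" and x :: "nat \<Rightarrow> real ^ 'd"
  assumes del: "delone_kset \<Lambda>" and inv: "invariant_prob_measure \<Lambda> \<mu>"
    and ev: "dynamical_eigenvalue \<mu> \<alpha>"
    and cover: "\<And>\<delta>. \<delta> > 0 \<Longrightarrow> \<forall>\<^sub>F n in sequentially. \<exists>Y. finite Y \<and> card Y \<le> N \<and>
           (\<forall>g. \<exists>y\<in>Y. kset_dist (translate (x n) (translate (g + y) \<Lambda>)) (translate (g + y) \<Lambda>) < \<delta>)"
  shows "(\<lambda>n. exp (2 * pi * \<i> * complex_of_real (x n \<bullet> \<alpha>))) \<longlonglongrightarrow> 1"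
proof -
  define X where "X = kset_hull \<Lambda>"
  have Xsub: "X \<subseteq> {\<Gamma>. delone_kset \<Gamma>}" by (auto simp: X_def kset_hull_iff[OF del])
  \<comment> \<open>The measure lives on the Borel sets of the subspace topology; as a metric space
    in its own right the hull can play the role of M in the abstract argument.\<close>
  interpret Submetric "{\<Gamma> :: ('d, 'k) kset. delone_kset \<Gamma>}" kset_dist X
    using Metric_space_kset_dist Xsub by (simp add: Submetric_def Submetric_axioms_def)
  have top: "sub.mtopology = subtopology kset_topology X"
    by (simp add: mtopology_submetric kset_topology_def)
  let ?G = "{U. openin sub.mtopology U}"
  have GX: "?G \<subseteq> Pow X" using openin_subset[of sub.mtopology] by auto
  have pr: "prob_space \<mu>" and distr: "\<And>g. distr \<mu> \<mu> (translate g) = \<mu>"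
    using inv unfolding invariant_prob_measure_def by blast+
  have sigma: "sets \<mu> = sets (sigma X ?G)"
    using inv unfolding invariant_prob_measure_def kset_hull_borel_def X_def[symmetric] top by blast
  then have sets: "sets \<mu> = sigma_sets X ?G" by (simp only: sets_measure_of[OF GX])
  have sp: "space \<mu> = X"
    using sets_eq_imp_space_eq[OF sigma] by (simp only: space_measure_of[OF GX])
  have open_sets: "U \<in> sets \<mu>" if "openin sub.mtopology U" for U
    unfolding sets using that by (intro sigma_sets.Basic) simp
  have tX: "translate g \<Gamma> \<in> X" if "\<Gamma> \<in> X" for g \<Gamma>
    using kset_hull_translate[OF del] that by (simp add: X_def)
  have meas: "translate g \<in> measurable \<mu> \<mu>" for g
  proof (rule measurable_sigma_sets[OF sets GX])
    show "translate g \<in> space \<mu> \<rightarrow> X" using tX sp by auto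
    fix U assume "U \<in> ?G"
    then have U: "openin sub.mtopology U" by simp
    have "openin sub.mtopology (translate g -` U \<inter> X)"
      unfolding sub.openin_mtopology
    proof (intro conjI allI impI)
      fix \<Gamma> assume \<Gamma>: "\<Gamma> \<in> translate g -` U \<inter> X"
      then obtain e where e: "e > 0" "sub.mball (translate g \<Gamma>) e \<subseteq> U"
        using U unfolding sub.openin_mtopology by blast
      obtain \<delta> where \<delta>: "\<delta> > 0" "\<And>\<Gamma>' :: ('d, 'k) kset. kset_dist \<Gamma> \<Gamma>' < \<delta> \<Longrightarrow> kset_dist (translate g \<Gamma>) (translate g \<Gamma>') < e"
        using kset_dist_translate_uniform[OF e(1)] by blast
      have "sub.mball \<Gamma> \<delta> \<subseteq> translate g -` U \<inter> X"
      proof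
        fix \<Gamma>' assume "\<Gamma>' \<in> sub.mball \<Gamma> \<delta>"
        then have "\<Gamma>' \<in> X" "kset_dist \<Gamma> \<Gamma>' < \<delta>" by auto
        then have "translate g \<Gamma>' \<in> sub.mball (translate g \<Gamma>) e" using \<delta>(2) tX \<Gamma> by auto
        then show "\<Gamma>' \<in> translate g -` U \<inter> X" using e \<open>\<Gamma>' \<in> X\<close> by blast
      qed
      then show "\<exists>r>0. sub.mball \<Gamma> r \<subseteq> translate g -` U \<inter> X" using \<delta> by blast
    qed auto
    then show "translate g -` U \<inter> space \<mu> \<in> sets \<mu>" using open_sets sp by simp
  qed
  have mp: "measure_preserving_map \<mu> (translate g)" for g
    unfolding measure_preserving_map_def using meas distr by blast
  have small_meas: "{\<Gamma> \<in> space \<mu>. kset_dist (translate g \<Gamma>) \<Gamma> < \<delta>} \<in> sets \<mu>" for g \<delta>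
  proof (rule open_sets)
    show "openin sub.mtopology {\<Gamma> \<in> space \<mu>. kset_dist (translate g \<Gamma>) \<Gamma> < \<delta>}"
      unfolding sub.openin_mtopology sp
    proof (intro conjI allI impI)
      fix \<Gamma> assume \<Gamma>: "\<Gamma> \<in> {\<Gamma> \<in> X. kset_dist (translate g \<Gamma>) \<Gamma> < \<delta>}"
      define e where "e = (\<delta> - kset_dist (translate g \<Gamma>) \<Gamma>) / 2"
      have e: "e > 0" using \<Gamma> by (simp add: e_def)
      obtain r where r: "r > 0" "\<And>\<Gamma> \<Gamma>' :: ('d, 'k) kset. kset_dist \<Gamma> \<Gamma>' < r \<Longrightarrow> kset_dist (translate g \<Gamma>) (translate g \<Gamma>') < e"
        using kset_dist_translate_uniform[OF e] by blast
      have "sub.mball \<Gamma> (min r e) \<subseteq> {\<Gamma> \<in> X. kset_dist (translate g \<Gamma>) \<Gamma> < \<delta>}"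
      proof
        fix \<Gamma>' assume "\<Gamma>' \<in> sub.mball \<Gamma> (min r e)"
        then have \<Gamma>': "\<Gamma>' \<in> X" "kset_dist \<Gamma> \<Gamma>' < r" "kset_dist \<Gamma> \<Gamma>' < e" by auto
        have "kset_dist (translate g \<Gamma>') \<Gamma>' \<le> kset_dist (translate g \<Gamma>') (translate g \<Gamma>)
            + (kset_dist (translate g \<Gamma>) \<Gamma> + kset_dist \<Gamma> \<Gamma>')"
          by (meson add_left_mono kset_dist_triangle order_trans)
        also have "\<dots> < e + (kset_dist (translate g \<Gamma>) \<Gamma> + e)"
          using r(2)[OF \<Gamma>'(2)] \<Gamma>'(3) by (simp add: kset_dist_commute)
        also have "\<dots> = \<delta>" by (simp add: e_def)
        finally show "\<Gamma>' \<in> {\<Gamma> \<in> X. kset_dist (translate g \<Gamma>) \<Gamma> < \<delta>}" using \<Gamma>' by simp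
      qed
      moreover have "min r e > 0" using r e by simp
      ultimately show "\<exists>r>0. sub.mball \<Gamma> r \<subseteq> {\<Gamma> \<in> X. kset_dist (translate g \<Gamma>) \<Gamma> < \<delta>}" by blast
    qed auto
  qed
  obtain f :: "('d, 'k) kset \<Rightarrow> complex" where f: "f \<in> borel_measurable \<mu>" "\<not> (AE \<Gamma> in \<mu>. f \<Gamma> = 0)"
      "\<And>g. AE \<Gamma> in \<mu>. f (translate g \<Gamma>) = exp (2 * pi * \<i> * (g \<bullet> \<alpha>)) * f \<Gamma>"
    using ev unfolding dynamical_eigenvalue_def by blast
  show ?thesis
  proof (rule sub.eigenvalue_phase_tendsto_1[OF pr sets f(1,2), where T = "\<lambda>n. translate (x n)"
        and H = "range translate" and N = N])
    show "measure_preserving_map \<mu> (translate (x n))" for n by (rule mp)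
    show "AE \<Gamma> in \<mu>. f (translate (x n) \<Gamma>) = exp (2 * pi * \<i> * complex_of_real (x n \<bullet> \<alpha>)) * f \<Gamma>" for n
      by (rule f(3))
    show "cmod (exp (2 * pi * \<i> * complex_of_real (x n \<bullet> \<alpha>))) = 1" for n
      by simp
    show "{\<Gamma> \<in> space \<mu>. kset_dist (translate (x n) \<Gamma>) \<Gamma> < \<delta>} \<in> sets \<mu>" for n \<delta> by (rule small_meas)
    show "measure_preserving_map \<mu> h" if "h \<in> range translate" for h using that mp by blast
    show "AE \<Gamma> in \<mu>. f (h \<Gamma>) = 0 \<longleftrightarrow> f \<Gamma> = 0" if h: "h \<in> range translate" for h
    proof -
      obtain g where g: "h = translate g" using h by blast
      show ?thesis unfolding g using f(3)[of g] by eventually_elim simp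
    qed
    fix \<delta> :: real assume \<delta>: "\<delta> > 0"
    then have "\<delta> / 2 > 0" by simp
    from cover[OF this]
    show "\<forall>\<^sub>F n in sequentially. \<exists>Y\<subseteq>range translate. finite Y \<and> card Y \<le> N \<and>
        (\<forall>\<Gamma>\<in>space \<mu>. \<exists>h\<in>Y. kset_dist (translate (x n) (h \<Gamma>)) (h \<Gamma>) < \<delta>)"
    proof eventually_elim
      case (elim n)
      then obtain Y where Y: "finite Y" "card Y \<le> N"
        "\<And>g. \<exists>y\<in>Y. kset_dist (translate (x n) (translate (g + y) \<Lambda>)) (translate (g + y) \<Lambda>) < \<delta> / 2" by blast
      show ?case
      proof (intro exI conjI ballI)
        show "translate ` Y \<subseteq> range translate" by blast
        show "finite (translate ` Y)" using Y by simp
        show "card (translate ` Y) \<le> N" using card_image_le[OF Y(1)] Y(2) by (rule order_trans)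
        fix \<Gamma> assume "\<Gamma> \<in> space \<mu>"
        then show "\<exists>h\<in>translate ` Y. kset_dist (translate (x n) (h \<Gamma>)) (h \<Gamma>) < \<delta>"
          using almost_period_cover_hull[OF del Y(1) \<delta> Y(3)] by (simp add: sp X_def)
      qed
    qed
  qed
qed

theorem proposition6p6:
  fixes \<Lambda> :: "('d::finite, 'k::finite) kset"
    and Q :: "real ^ 'd \<Rightarrow> real ^ 'd"
    and D :: "'k \<Rightarrow> 'k \<Rightarrow> (real ^ 'd) set"
    and \<mu> :: "('d, 'k) kset measure"
  assumes "substitution_delone_kset Q D \<Lambda>"
    and "primitive_substitution D"
    and "representable Q D \<Lambda>"
    and "repetitive \<Lambda>"
    and "invariant_prob_measure \<Lambda> \<mu>"
    and "\<forall>z. is_eigenvalue Q z \<longrightarrow> algebraic_int z"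
    and "relatively_dense {\<alpha>. dynamical_eigenvalue \<mu> \<alpha>}"
  shows "meyer (supp \<Lambda>)"
proof -
  note sub = assms(1)[unfolded substitution_delone_kset_def]
  have delone: "delone_kset \<Lambda>" by (rule sub[THEN conjunct1])
  have Q: "expansive Q" by (rule sub[THEN conjunct2, THEN conjunct1])
  obtain A where A: "prototiles Q D A" "tiling {((+) x ` A i, i) |x i. x \<in> \<Lambda> i}"
    using assms(3) by (auto simp: representable_def)
  have "bounded (\<Union>i. A i)"
    using A(1) by (intro bounded_UN) (auto simp: prototiles_def compact_imp_bounded)
  then obtain \<rho> where \<rho>: "\<forall>x\<in>(\<Union>i. A i). norm x \<le> \<rho>" by (auto simp: bounded_iff)
  interpret supertiles Q D \<Lambda> A \<rho>
  proof
    show "expansive Q" by (rule Q)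
    show "finite (D i j)" for i j
      using sub[THEN conjunct2, THEN conjunct2, THEN conjunct1] by blast
    show "\<Lambda> i = (\<Union>j. \<Union>a\<in>D i j. (\<lambda>x. Q x + a) ` \<Lambda> j)" for i
      by (rule sub[THEN conjunct2, THEN conjunct2, THEN conjunct2, THEN conjunct1, THEN spec])
    show "delone (\<Lambda> i)" for i using delone by (simp add: delone_kset_def)
    show "A i \<subseteq> cball 0 \<rho>" for i using \<rho> by auto
  qed (rule assms(2) A)+
  show ?thesis
  proof (rule meyer_of_summable_phases[OF assms(1,7)])
    fix k p q assume pq: "p \<in> \<Lambda> k" "q \<in> \<Lambda> k"
    show "summable_phases Q {\<alpha>. dynamical_eigenvalue \<mu> \<alpha>} (p - q)"
      unfolding summable_phases_def
    proof
      fix \<alpha> assume "\<alpha> \<in> {\<alpha>. dynamical_eigenvalue \<mu> \<alpha>}"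
      then have ev: "dynamical_eigenvalue \<mu> \<alpha>" by simp
      \<comment> \<open>The covering lemma speaks of q - p, so the two points enter in exchanged
        order.\<close>
      obtain N where N: "\<And>\<delta>. \<delta> > 0 \<Longrightarrow> \<forall>\<^sub>F n in sequentially. \<exists>Y. finite Y \<and> card Y \<le> N \<and>
           (\<forall>g. \<exists>y\<in>Y. kset_dist (translate ((Q ^^ n) (p - q)) (translate (g + y) \<Lambda>)) (translate (g + y) \<Lambda>) < \<delta>)"
        using almost_period_cover[OF assms(4) pq(2,1)] by blast
      have "(\<lambda>n. exp (2 * pi * \<i> * complex_of_real ((Q ^^ n) (p - q) \<bullet> \<alpha>))) \<longlonglongrightarrow> 1"
        by (rule eigenvalue_phases_tendsto_1[OF delone assms(5) ev N])
      moreover obtain P where "integer_monic P"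
          "\<And>n. shift_poly P (\<lambda>n. complex_of_real ((Q ^^ n) (p - q) \<bullet> \<alpha>)) n = 0"
        using integer_recurrence[OF linQ] assms(6) by blast
      ultimately show "summable (\<lambda>n. int_dist ((Q ^^ n) (p - q) \<bullet> \<alpha>))"
        by (intro int_dist_summable)
    qed
  qed
qed

end
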